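(* (Monodromy space of type $(0,-,2)$, Painlevé IV.) Let $AnalyticData=\mathrm{Spec}\,\mathbb{C}[\alpha,\alpha^{-1},a_1,a_2,a_3,a_4]$ and let $\mathbb{G}_m$ act with weights $0,+1,-1,+1,-1$ on $\alpha,a_1,a_2,a_3,a_4$. Put $$top_\infty=\begin{pmatrix}\alpha&0\\ 0&\alpha^{-1}\end{pmatrix}\begin{pmatrix}1&0\\ a_1&1\end{pmatrix}\begin{pmatrix}1&a_2\\ 0&1\end{pmatrix}\begin{pmatrix}1&0\\ a_3&1\end{pmatrix}\begin{pmatrix}1&a_4\\ 0&1\end{pmatrix},$$ $\mathcal{R}=AnalyticData/\!/\mathbb{G}_m$, and let $\mathcal{R}\to\mathcal{P}=\mathbb{C}\times\mathbb{C}^*$ be given by $(s_1,s_2)=(\mathrm{tr}(top_\infty),\alpha)$. With $x_1=a_1a_4+s_2^2$, $x_2=a_1a_2+1$, $x_3=a_3a_4+1$ the coordinate ring of $\mathcal{R}$ is $\mathbb{C}[s_1,s_2,s_2^{-1},x_1,x_2,x_3]$ modulo the single relation $$x_1x_2x_3+x_1^2-(s_2^2+s_1s_2)x_1-s_2^2x_2-s_2^2x_3+s_2^2+s_1s_2^3=0 ,$$ so $\mathcal{R}\to\mathcal{P}$ is a family of affine cubic surfaces. The singular locus of $\mathcal{R}$ is given by $x_1=s_2^2$, $x_2=1$, $x_3=1$, $s_1=s_2+s_2^{-1}$; it is the image of the reducible data ($a_1=a_3=0$ or $a_2=a_4=0$). The fibre over $(s_1,s_2)$ is singular if and only if $$(s_1-2)(s_1+2)(s_2^2-s_1s_2+1)=0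 .$$ In these cases the singular fibre has a single singular point, as follows: for $s_1=2$, $s_2\neq1$: the point $(s_2,s_2,s_2)$, of type $A_1$; for $s_1=-2$, $s_2\ne-1$: the point $(-s_2,-s_2,-s_2)$, of type $A_1$; for $s_1=s_2+s_2^{-1}$, $s_2\neq\pm1$: the point $(s_2^2,1,1)$, of type $A_1$; for $(s_1,s_2)=(2,1)$ or $(-2,-1)$: the point $(1,1,1)$, of type $A_2$.
   Context: $X/\!/G$ denotes the categorical quotient $\mathrm{Spec}(\mathcal{O}(X)^G)$ of an affine variety by a reductive group. A surface singularity is of type $A_n$ if it is locally analytically given by $x^2+y^2+z^{n+1}=0$. Origin of the data: rank-two differential modules on $\mathbb{P}^1$ (trivial determinant) with a regular singularity at $0$ and an unramified irregular singularity of Katz invariant $2$ at $\infty$; $top_\infty$ is the product of formal monodromy and four Stokes matrices, and the monodromy at $0$ is $top_\infty^{-1}$. *)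

theory Defs
  imports "HOL-Analysis.Analysis" "HOL-Library.Poly_Mapping"
begin

(* Coordinate rings are monoid algebras over the complex numbers.
   laurent is C[u, 1/u, y_1, ..., y_4]. It is used twice:
     as O(AnalyticData), with u = alpha and y_i = a_i;
     as the coordinate ring C[s1, s2, 1/s2, x1, x2, x3] of the ambient space of R,
     with u = s2 and (y_1, y_2, y_3, y_4) = (s1, x1, x2, x3).
   In the index type 4 the numeral 4 denotes 0, so 1, 2, 3, 4 are its four elements. *)

type_synonym laurent = "(int \<times> (4 \<Rightarrow>\<^sub>0 nat)) \<Rightarrow>\<^sub>0 complex"
type_synonym poly3 = "(3 \<Rightarrow>\<^sub>0 nat) \<Rightarrow>\<^sub>0 complex"

definition Const :: "complex \<Rightarrow> ('k::zero \<Rightarrow>\<^sub>0 complex)"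
  where "Const c = Poly_Mapping.single 0 c"

definition U :: laurent
  where "U = Poly_Mapping.single (1, 0) 1"

definition Uinv :: laurent
  where "Uinv = Poly_Mapping.single (-1, 0) 1"

definition Y :: "4 \<Rightarrow> laurent"
  where "Y i = Poly_Mapping.single (0, Poly_Mapping.single i 1) 1"

definition Z :: "3 \<Rightarrow> poly3"
  where "Z i = Poly_Mapping.single (Poly_Mapping.single i 1) 1"

definition monom_at :: "('r::comm_ring_1)^'n::finite \<Rightarrow> ('n \<Rightarrow>\<^sub>0 nat) \<Rightarrow> 'r"
  where "monom_at z m = (\<Prod>i\<in>UNIV. (z $ i) ^ Poly_Mapping.lookup m i)"

(* The C[u, 1/u]-algebra endomorphism of laurent sending y_i to z_i. *)
definition lsubst :: "laurent^4 \<Rightarrow> laurent \<Rightarrow> laurent"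
  where "lsubst z f = (\<Sum>m\<in>Poly_Mapping.keys f.
    Poly_Mapping.single (fst m, 0) (Poly_Mapping.lookup f m) * monom_at z (snd m))"

(* The C-algebra homomorphism sending the i-th variable to z_i. *)
definition psubst :: "laurent^3 \<Rightarrow> poly3 \<Rightarrow> laurent"
  where "psubst z g = (\<Sum>m\<in>Poly_Mapping.keys g.
    Const (Poly_Mapping.lookup g m) * monom_at z m)"

definition leval :: "laurent \<Rightarrow> complex \<times> (complex^4) \<Rightarrow> complex"
  where "leval f p = (\<Sum>m\<in>Poly_Mapping.keys f.
    Poly_Mapping.lookup f m * (fst p powi fst m) * monom_at (snd p) (snd m))"

definition peval :: "poly3 \<Rightarrow> complex^3 \<Rightarrow> complex"
  where "peval g p = (\<Sum>m\<in>Poly_Mapping.keys g. Poly_Mapping.lookup g m * monom_at p m)"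

definition total_degree :: "poly3 \<Rightarrow> nat"
  where "total_degree g =
    Max (insert 0 ((\<lambda>m. \<Sum>i\<in>UNIV. Poly_Mapping.lookup m i) ` Poly_Mapping.keys g))"


definition diag2 :: "'r \<Rightarrow> 'r \<Rightarrow> ('r::comm_ring_1)^2^2"
  where "diag2 v w = vector [vector [v, 0], vector [0, w]]"

definition lower2 :: "'r \<Rightarrow> ('r::comm_ring_1)^2^2"
  where "lower2 a = vector [vector [1, 0], vector [a, 1]]"

definition upper2 :: "'r \<Rightarrow> ('r::comm_ring_1)^2^2"
  where "upper2 a = vector [vector [1, a], vector [0, 1]]"

definition top_infinity :: "laurent^2^2"
  where "top_infinity =
    diag2 U Uinv ** lower2 (Y 1) ** upper2 (Y 2) ** lower2 (Y 3) ** upper2 (Y 4)"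

definition gm_act :: "complex \<Rightarrow> laurent \<Rightarrow> laurent"
  where "gm_act t = lsubst (vector
    [Const t * Y 1, Const (inverse t) * Y 2, Const t * Y 3, Const (inverse t) * Y 4])"

(* The coordinate ring of R = AnalyticData // G_m; it suffices to test invariance on the
   C-points of G_m. *)
definition O_R :: "laurent set"
  where "O_R = {f. \<forall>t. t \<noteq> 0 \<longrightarrow> gm_act t f = f}"

definition tr_top :: laurent
  where "tr_top = trace top_infinity"

definition x1 :: laurent where "x1 = Y 1 * Y 4 + U ^ 2"
definition x2 :: laurent where "x2 = Y 1 * Y 2 + 1"
definition x3 :: laurent where "x3 = Y 3 * Y 4 + 1"

(* The homomorphism C[s1, s2, 1/s2, x1, x2, x3] \<rightarrow> O(AnalyticData), s2 going to alpha. *)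
definition pres :: "laurent \<Rightarrow> laurent"
  where "pres = lsubst (vector [tr_top, x1, x2, x3])"

definition cubic :: "'r \<Rightarrow> 'r \<Rightarrow> 'r \<Rightarrow> 'r \<Rightarrow> 'r \<Rightarrow> 'r::comm_ring_1"
  where "cubic s1 s2 \<xi>1 \<xi>2 \<xi>3 =
    \<xi>1 * \<xi>2 * \<xi>3 + \<xi>1^2 - (s2^2 + s1 * s2) * \<xi>1 - s2^2 * \<xi>2 - s2^2 * \<xi>3 + s2^2 + s1 * s2^3"

definition cubic_total :: laurent
  where "cubic_total = cubic (Y 1) U (Y 2) (Y 3) (Y 4)"

definition cubic_fibre :: "complex \<Rightarrow> complex \<Rightarrow> poly3"
  where "cubic_fibre s1 s2 = cubic (Const s1) (Const s2) (Z 1) (Z 2) (Z 3)"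

(* The ideal of O_R defining the scheme-theoretic fibre of R \<rightarrow> P over (s1, s2). *)
definition fibre_ideal :: "complex \<Rightarrow> complex \<Rightarrow> laurent set"
  where "fibre_ideal s1 s2 =
    {(tr_top - Const s1) * f + (U - Const s2) * g | f g. f \<in> O_R \<and> g \<in> O_R}"

(* Defining ideals of R in C \<times> C^* \<times> C^3 and of the fibres in C^3. *)
definition ideal_R :: "laurent set"
  where "ideal_R = {f. pres f = 0}"

definition ideal_fibre :: "complex \<Rightarrow> complex \<Rightarrow> poly3 set"
  where "ideal_fibre s1 s2 = {g. psubst (vector [x1, x2, x3]) g \<in> fibre_ideal s1 s2}"

(* Jacobian definition of the singular points of the subscheme of the open set M with
   ideal I, in codimension 1: the differentials at p of the elements of I have
   rank < 1. R and its fibres are hypersurfaces, so the codimension is 1 here. *)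
definition hypersurface_singular_locus ::
    "'a::real_normed_vector set \<Rightarrow> ('a \<Rightarrow> complex) set \<Rightarrow> 'a set"
  where "hypersurface_singular_locus M I =
    {p\<in>M. \<forall>f\<in>I. f p = 0 \<and> (f has_derivative (\<lambda>_. 0)) (at p)}"

(* Closed points of R, in the order (s2, (s1, x1, x2, x3)). *)
definition sing_R :: "(complex \<times> (complex^4)) set"
  where "sing_R = hypersurface_singular_locus {p. fst p \<noteq> 0} (leval ` ideal_R)"

definition sing_fibre :: "complex \<Rightarrow> complex \<Rightarrow> (complex^3) set"
  where "sing_fibre s1 s2 = hypersurface_singular_locus UNIV (peval ` ideal_fibre s1 s2)"

(* Holomorphic functions of several variables: complex differentiable on the open set S. *)
definition holo :: "(complex^'n::finite) set \<Rightarrow> (complex^'n \<Rightarrow> complex) \<Rightarrow> bool"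
  where "holo S f \<longleftrightarrow>
    (\<forall>p\<in>S. \<exists>D. (f has_derivative D) (at p) \<and> (\<forall>c v. D (c *s v) = c * D v))"

(* After a biholomorphic change of coordinates \<Phi> near p with \<Phi> p = 0, the germs of the
   functions in I generate the same ideal as x^2 + y^2 + z^(n+1). *)
definition singularity_type_A :: "nat \<Rightarrow> (complex^3 \<Rightarrow> complex) set \<Rightarrow> complex^3 \<Rightarrow> bool"
  where "singularity_type_A n I p \<longleftrightarrow>
    (\<exists>S T (\<Phi> :: complex^3 \<Rightarrow> complex^3) \<Psi>. open S \<and> open T \<and> p \<in> S \<and> \<Phi> p = 0 \<and> homeomorphism S T \<Phi> \<Psi> \<and>
      (\<forall>i. holo S (\<lambda>q. \<Phi> q $ i)) \<and> (\<forall>i. holo T (\<lambda>r. \<Psi> r $ i)) \<and>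
      (let g = (\<lambda>q. (\<Phi> q $ 1)^2 + (\<Phi> q $ 2)^2 + (\<Phi> q $ 3)^(n+1)) in
        (\<forall>f\<in>I. \<exists>h. holo S h \<and> (\<forall>q\<in>S. f q = h q * g q)) \<and>
        (\<exists>J h. finite J \<and> J \<subseteq> I \<and> (\<forall>f\<in>J. holo S (h f)) \<and>
          (\<forall>q\<in>S. g q = (\<Sum>f\<in>J. h f q * f q)))))"

definition fibre_type_A :: "nat \<Rightarrow> complex \<Rightarrow> complex \<Rightarrow> complex^3 \<Rightarrow> bool"
  where "fibre_type_A n s1 s2 p = singularity_type_A n (peval ` ideal_fibre s1 s2) p"

definition analytic_data :: "(complex \<times> (complex^4)) set"
  where "analytic_data = {p. fst p \<noteq> 0}"

(* The data are reducible if there is a line in the solution space invariant under the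
   exponential torus (hence under the formal monodromy) and the Stokes matrices. *)
definition reducible_data :: "(complex \<times> (complex^4)) set"
  where "reducible_data = {p \<in> analytic_data. \<exists>W::(complex^2) set.
    vec.subspace W \<and> W \<noteq> {0} \<and> W \<noteq> UNIV \<and>
    (\<forall>M \<in> {diag2 c (inverse c) | c. c \<noteq> 0} \<union>
        {lower2 (snd p $ 1), upper2 (snd p $ 2), lower2 (snd p $ 3), upper2 (snd p $ 4)}.
      \<forall>v\<in>W. M *v v \<in> W)}"

(* The quotient morphism AnalyticData \<rightarrow> R on closed points. *)
definition gm_quotient_map :: "complex \<times> (complex^4) \<Rightarrow> complex \<times> (complex^4)"
  where "gm_quotient_map p =
    (leval U p, vector [leval tr_top p, leval x1 p, leval x2 p, leval x3 p])"

end

(* The cubic equation is s2^2 (B12 B34 - B14 B32) = 0, where the B_ij are the expressions in the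
   coordinates (s1, s2, x1, x2, x3) that represent the basic invariants a_i a_j. Invariants are
   spanned by monomials of weight 0; writing each of them in the a_i a_j gives a linear section of
   the presentation that is multiplicative modulo the cubic, and both the surjectivity and the
   kernel of the presentation follow from this section. The equations of the fibres follow by
   specialising s1 and s2.

   The singularities come from the identity
   x1 * cubic = (x1 x2 - s2^2) (x1 x3 - s2^2) + (x1 - s2^2) (x1^2 - s1 s2 x1 + s2^2):
   the singular points of a fibre correspond to the multiple roots of the cubic polynomial in x1,
   and a root of multiplicity k gives a singularity of type A_(k-1). *)

theory Submission
  imports Defs
begin

text \<open>The hard half of the presentation is that its kernel is no larger than the ideal of the
  cubic. No primality or dimension argument enters; an inverse modulo the cubic is written down
  instead. A weight-zero monomial is in general a product of the a_i a_j in several ways, but two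
  such ways differ only by exchanging (a_1 a_4)(a_3 a_2) for (a_1 a_2)(a_3 a_4), and since s2 is a
  unit this exchange generates the same ideal as the cubic. So an arbitrary choice of factorisation
  becomes multiplicative modulo the cubic. The product a_3 a_2 is the only one that x1, x2, x3 and
  s2 do not give directly: it is obtained by solving the trace for it, which needs s1 and 1/s2. For
  the fibres, the gradient gives x1 x3 = s2^2, so x1 is nonzero at every singular point and
  multiplying the equation by x1 loses nothing there.\<close>

section \<open>Additive extension from monomials, and generators of the monoid algebras\<close>

lemma poly_mapping_eq_sum_single:
  fixes f :: "'k \<Rightarrow>\<^sub>0 'a::comm_monoid_add"
  shows "f = (\<Sum>k\<in>Poly_Mapping.keys f. Poly_Mapping.single k (Poly_Mapping.lookup f k))"
  by (rule poly_mapping_eqI)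
     (auto simp: lookup_sum lookup_single when_def in_keys_iff sum.delta')

lemma poly_mapping_single_induct [case_names single add]:
  fixes f :: "'k \<Rightarrow>\<^sub>0 'a::comm_monoid_add"
  assumes single: "\<And>k c. P (Poly_Mapping.single k c)"
    and add: "\<And>f g. P f \<Longrightarrow> P g \<Longrightarrow> P (f + g)"
  shows "P f"
proof -
  have "P (\<Sum>k\<in>K. Poly_Mapping.single k (Poly_Mapping.lookup f k))" if "finite K" for K
    using that
  proof (induction K rule: finite_induct)
    case empty
    show ?case using single[of undefined 0] by simp
  next
    case (insert x F)
    then show ?case by (simp add: single add)
  qed
  from this[OF finite_keys[of f]] show ?thesis by (simp flip: poly_mapping_eq_sum_single)
qed

text \<open>Common shape of \<open>lsubst\<close>, \<open>psubst\<close>, \<open>leval\<close>,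
  \<open>peval\<close>, \<open>sec\<close> and \<open>specialize\<close>. A sum over
  \<open>keys\<close> is not visibly additive because terms may cancel, so additivity and
  multiplicativity are settled once here.\<close>

definition mono_ext :: "('k \<Rightarrow> 'a \<Rightarrow> 'r) \<Rightarrow> ('k \<Rightarrow>\<^sub>0 'a::zero) \<Rightarrow> 'r::comm_monoid_add"
  where "mono_ext \<phi> f = (\<Sum>k\<in>Poly_Mapping.keys f. \<phi> k (Poly_Mapping.lookup f k))"

lemma mono_ext_single: "\<phi> k 0 = 0 \<Longrightarrow> mono_ext \<phi> (Poly_Mapping.single k c) = \<phi> k c"
  by (simp add: mono_ext_def)

lemma mono_ext_add:
  fixes f g :: "'k \<Rightarrow>\<^sub>0 'a::comm_monoid_add"
  assumes "\<And>k. \<phi> k 0 = 0" "\<And>k a b. \<phi> k (a + b) = \<phi> k a + \<phi> k b"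
  shows "mono_ext \<phi> (f + g) = mono_ext \<phi> f + mono_ext \<phi> g"
  unfolding mono_ext_def by (rule setsum_keys_plus_distrib) (simp_all add: assms)

text \<open>Both sides are additive in each factor, which reduces the claim to the product of two
  single terms.\<close>

lemma mono_ext_mult:
  fixes f g :: "'k::monoid_add \<Rightarrow>\<^sub>0 'a::semiring_0"
    and \<phi> :: "'k \<Rightarrow> 'a \<Rightarrow> 'r::semiring_0"
  assumes z: "\<And>k. \<phi> k 0 = 0" and a: "\<And>k a b. \<phi> k (a + b) = \<phi> k a + \<phi> k b"
    and m: "\<And>k l a b. \<phi> (k + l) (a * b) = \<phi> k a * \<phi> l b"
  shows "mono_ext \<phi> (f * g) = mono_ext \<phi> f * mono_ext \<phi> g"
proof (induction f rule: poly_mapping_single_induct)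
  case (single k c)
  show ?case
    by (induction g rule: poly_mapping_single_induct)
       (simp_all add: mult_single mono_ext_single mono_ext_add z a m distrib_left)
next
  case (add f f')
  then show ?case by (simp add: mono_ext_add z a distrib_right)
qed

lemma monom_at_0: "monom_at z 0 = 1"
  by (simp add: monom_at_def)

lemma monom_at_add: "monom_at z (m + n) = monom_at z m * monom_at z n"
  by (simp add: monom_at_def lookup_add power_add prod.distrib)

lemma monom_at_single: "monom_at z (Poly_Mapping.single i k) = (z $ i) ^ k"
proof -
  have "monom_at z (Poly_Mapping.single i k) = (\<Prod>j\<in>UNIV. if j = i then (z $ i) ^ k else 1)"
    unfolding monom_at_def by (rule prod.cong) (auto simp: lookup_single when_def)
  then show ?thesis by simp
qed

lemma single_zero_fst_snd [simp]: "(0::'a::zero, 0::'b::zero) = 0"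
  by (simp add: zero_prod_def)

lemma Const_add: "Const (a + b) = Const a + Const b"
  by (simp add: Const_def single_add)

lemma Const_mult: "Const (a * b) = (Const a * Const b :: 'k::monoid_add \<Rightarrow>\<^sub>0 complex)"
  by (simp add: Const_def mult_single)

lemma Const_0: "Const 0 = 0"
  by (simp add: Const_def)

lemma Const_1: "Const 1 = 1"
  by (simp add: Const_def)

lemma Const_power: "Const (a ^ n) = (Const a ^ n :: 'k::monoid_add \<Rightarrow>\<^sub>0 complex)"
  by (induction n) (simp_all add: Const_1 Const_mult)

lemma U_Uinv: "U * Uinv = 1"
  by (simp add: U_def Uinv_def mult_single)

text \<open>Link between products of generators and the monomial basis: it rebuilds a term from
  generators for induction, and recognises the outcome of \<open>gm_act\<close> and of
  \<open>pres\<close> as a term.\<close>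

lemma monom_at_Y: "Poly_Mapping.single (e, 0) c * monom_at (\<chi> i. Y i) m = (Poly_Mapping.single (e, m) c :: laurent)"
proof -
  have p: "Y i ^ k = Poly_Mapping.single (0, Poly_Mapping.single i k) 1" for i k
    by (induction k) (simp_all add: Y_def mult_single single_add[symmetric])
  have "(\<Prod>i\<in>I. Poly_Mapping.single (0, f i) 1) = (Poly_Mapping.single (0, \<Sum>i\<in>I. f i) 1 :: laurent)"
    if "finite I" for I :: "4 set" and f
    using that by (induction I rule: finite_induct) (simp_all add: mult_single)
  moreover have "(\<Sum>i\<in>UNIV. Poly_Mapping.single i (Poly_Mapping.lookup m i)) = m"
    by (rule poly_mapping_eqI) (auto simp: lookup_sum lookup_single when_def sum.delta')
  ultimately have "monom_at (\<chi> i. Y i) m = Poly_Mapping.single (0, m) 1"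
    by (simp add: monom_at_def p)
  then show ?thesis by (simp add: mult_single)
qed

lemma monom_at_Z: "Const c * monom_at (\<chi> i. Z i) m = (Poly_Mapping.single m c :: poly3)"
proof -
  have p: "Z i ^ k = Poly_Mapping.single (Poly_Mapping.single i k) 1" for i k
    by (induction k) (simp_all add: Z_def mult_single single_add[symmetric])
  have "(\<Prod>i\<in>I. Poly_Mapping.single (f i) 1) = (Poly_Mapping.single (\<Sum>i\<in>I. f i) 1 :: poly3)"
    if "finite I" for I :: "3 set" and f
    using that by (induction I rule: finite_induct) (simp_all add: mult_single)
  moreover have "(\<Sum>i\<in>UNIV. Poly_Mapping.single i (Poly_Mapping.lookup m i)) = m"
    by (rule poly_mapping_eqI) (auto simp: lookup_sum lookup_single when_def sum.delta')
  ultimately have "monom_at (\<chi> i. Z i) m = Poly_Mapping.single m 1"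
    by (simp add: monom_at_def p)
  then show ?thesis by (simp add: mult_single Const_def)
qed

text \<open>The Laurent variable is absorbed in the scalars, so that negative powers need no case of
  their own.\<close>

lemma laurent_induct [case_names scalar Y add mult]:
  fixes f :: laurent
  assumes scalar: "\<And>e c. P (Poly_Mapping.single (e, 0) c)" and Y: "\<And>i. P (Y i)"
    and add: "\<And>f g. P f \<Longrightarrow> P g \<Longrightarrow> P (f + g)"
    and mult: "\<And>f g. P f \<Longrightarrow> P g \<Longrightarrow> P (f * g)"
  shows "P f"
proof (induction f rule: poly_mapping_single_induct)
  case (single k c)
  have one: "P 1" using scalar[of 0 1] by simp
  have pow: "P (Y i ^ n)" for i n
    by (induction n) (auto simp: one Y intro: mult)
  have "P (\<Prod>i\<in>I. Y i ^ Poly_Mapping.lookup (snd k) i)" if "finite I" for I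
    using that by (induction I rule: finite_induct) (auto simp: one pow intro: mult)
  then have "P (monom_at (\<chi> i. Y i) (snd k))" by (simp add: monom_at_def)
  from mult[OF scalar[of "fst k" c] this] show ?case by (simp add: monom_at_Y)
qed (rule add)

lemma poly3_induct [case_names scalar Z add mult]:
  fixes f :: poly3
  assumes scalar: "\<And>c. P (Const c)" and Z: "\<And>i. P (Z i)"
    and add: "\<And>f g. P f \<Longrightarrow> P g \<Longrightarrow> P (f + g)"
    and mult: "\<And>f g. P f \<Longrightarrow> P g \<Longrightarrow> P (f * g)"
  shows "P f"
proof (induction f rule: poly_mapping_single_induct)
  case (single k c)
  have one: "P 1" using scalar[of 1] by (simp add: Const_1)
  have pow: "P (Z i ^ n)" for i n
    by (induction n) (auto simp: one Z intro: mult)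
  have "P (\<Prod>i\<in>I. Z i ^ Poly_Mapping.lookup k i)" if "finite I" for I
    using that by (induction I rule: finite_induct) (auto simp: one pow intro: mult)
  then have "P (monom_at (\<chi> i. Z i) k)" by (simp add: monom_at_def)
  from mult[OF scalar[of c] this] show ?case by (simp add: monom_at_Z)
qed (rule add)

subsection \<open>Substitutions and evaluations as ring homomorphisms\<close>

text \<open>A locale, because some of the maps are homomorphisms only under a side condition and are
  interpreted inside proofs. The rule for \<open>cubic\<close> carries \<open>cubic_total\<close> to
  its specialisations and values.\<close>

locale ring_hom_fun =
  fixes h :: "'a::comm_ring_1 \<Rightarrow> 'b::comm_ring_1"
  assumes add: "h (f + g) = h f + h g" and mult: "h (f * g) = h f * h g" and one: "h 1 = 1"
begin

lemma zero: "h 0 = 0"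
  using add[of 0 0] by simp

lemma uminus: "h (- f) = - h f"
  using add[of f "- f"] by (simp add: zero eq_neg_iff_add_eq_0 add.commute)

lemma diff: "h (f - g) = h f - h g"
  using add[of f "- g"] by (simp add: uminus)

lemma power: "h (f ^ n) = h f ^ n"
  by (induction n) (simp_all add: one mult)

lemma cubic: "h (cubic a b c d e) = cubic (h a) (h b) (h c) (h d) (h e)"
  by (simp add: cubic_def add diff mult power)

lemmas simps = add mult one zero uminus diff power cubic

end

lemma lsubst_eq_mono_ext:
  "lsubst z = mono_ext (\<lambda>m c. Poly_Mapping.single (fst m, 0) c * monom_at z (snd m))"
  by (rule ext) (simp add: lsubst_def mono_ext_def)

lemma lsubst_single:
  "lsubst z (Poly_Mapping.single m c) = Poly_Mapping.single (fst m, 0) c * monom_at z (snd m)"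
  by (simp add: lsubst_eq_mono_ext mono_ext_single)

lemma ring_hom_lsubst: "ring_hom_fun (lsubst z)"
proof
  fix f g :: laurent
  show "lsubst z (f + g) = lsubst z f + lsubst z g"
    unfolding lsubst_eq_mono_ext
    by (rule mono_ext_add) (simp_all add: single_add distrib_right)
  have s: "Poly_Mapping.single (e + e', 0) (c * c')
      = (Poly_Mapping.single (e, 0) c * Poly_Mapping.single (e', 0) c' :: laurent)" for e e' c c'
    by (simp add: mult_single)
  show "lsubst z (f * g) = lsubst z f * lsubst z g"
    unfolding lsubst_eq_mono_ext
    by (rule mono_ext_mult) (simp_all add: single_add distrib_left distrib_right monom_at_add s ac_simps)
  show "lsubst z 1 = 1"
    using lsubst_single[of z 0 1] by (simp add: monom_at_0)
qed

interpretation lsubst: ring_hom_fun "lsubst z" for z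
  by (rule ring_hom_lsubst)

lemma lsubst_scalar [simp]: "lsubst z (Poly_Mapping.single (e, 0) c) = Poly_Mapping.single (e, 0) c"
  by (simp add: lsubst_single monom_at_0)

lemma lsubst_Y [simp]: "lsubst z (Y i) = z $ i"
  by (simp add: Y_def lsubst_single monom_at_single)

lemma lsubst_U [simp]: "lsubst z U = U" and lsubst_Uinv [simp]: "lsubst z Uinv = Uinv"
  by (simp_all add: U_def Uinv_def)

lemma lsubst_Const [simp]: "lsubst z (Const c) = Const c"
  using lsubst_scalar[of z 0 c] by (simp add: Const_def)

lemma psubst_eq_mono_ext: "psubst z = mono_ext (\<lambda>m c. Const c * monom_at z m)"
  by (rule ext) (simp add: psubst_def mono_ext_def)

lemma psubst_single: "psubst z (Poly_Mapping.single m c) = Const c * monom_at z m"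
  by (simp add: psubst_eq_mono_ext mono_ext_single Const_0)

interpretation psubst: ring_hom_fun "psubst z" for z
proof
  fix f g :: poly3
  show "psubst z (f + g) = psubst z f + psubst z g"
    unfolding psubst_eq_mono_ext
    by (rule mono_ext_add) (simp_all add: Const_0 Const_add distrib_right)
  show "psubst z (f * g) = psubst z f * psubst z g"
    unfolding psubst_eq_mono_ext
    by (rule mono_ext_mult) (simp_all add: Const_0 Const_add Const_mult distrib_left distrib_right monom_at_add ac_simps)
  show "psubst z 1 = 1"
    using psubst_single[of z 0 1] by (simp add: monom_at_0 Const_1)
qed

lemma psubst_Const [simp]: "psubst z (Const c) = Const c"
  using psubst_single[of z 0 c] by (simp add: monom_at_0 Const_def)

lemma psubst_Z [simp]: "psubst z (Z i) = z $ i"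
  by (simp add: Z_def psubst_single monom_at_single Const_1)

lemma leval_eq_mono_ext:
  "(\<lambda>f. leval f p) = mono_ext (\<lambda>m c. c * (fst p powi fst m) * monom_at (snd p) (snd m))"
  by (rule ext) (simp add: leval_def mono_ext_def)

lemma leval_single:
  "leval (Poly_Mapping.single m c) p = c * (fst p powi fst m) * monom_at (snd p) (snd m)"
  using fun_cong[OF leval_eq_mono_ext, of "Poly_Mapping.single m c" p]
  by (simp add: mono_ext_single)

text \<open>At 0 the relation \<open>U * Uinv = 1\<close> would be lost, since
  \<open>inverse 0 = 0\<close>; away from 0 integer exponents add.\<close>

lemma ring_hom_leval:
  assumes "fst p \<noteq> 0"
  shows "ring_hom_fun (\<lambda>f. leval f p)"
proof
  fix f g :: laurent
  show "leval (f + g) p = leval f p + leval g p"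
    unfolding fun_cong[OF leval_eq_mono_ext]
    by (rule mono_ext_add) (simp_all add: algebra_simps)
  show "leval (f * g) p = leval f p * leval g p"
    unfolding fun_cong[OF leval_eq_mono_ext]
    by (rule mono_ext_mult) (simp_all add: assms power_int_add monom_at_add algebra_simps)
  show "leval 1 p = 1"
    using leval_single[of 0 1 p] by (simp add: monom_at_0)
qed

lemma leval_U [simp]: "leval U p = fst p" and leval_Uinv [simp]: "leval Uinv p = inverse (fst p)"
  by (simp_all add: U_def Uinv_def leval_single monom_at_0 power_int_minus)

lemma leval_Y [simp]: "leval (Y i) p = snd p $ i"
  by (simp add: Y_def leval_single monom_at_single)

lemma peval_eq_mono_ext: "(\<lambda>f. peval f p) = mono_ext (\<lambda>m c. c * monom_at p m)"
  by (rule ext) (simp add: peval_def mono_ext_def)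

lemma peval_single: "peval (Poly_Mapping.single m c) p = c * monom_at p m"
  using fun_cong[OF peval_eq_mono_ext, of "Poly_Mapping.single m c" p]
  by (simp add: mono_ext_single)

interpretation peval: ring_hom_fun "\<lambda>f. peval f p" for p
proof
  fix f g :: poly3
  show "peval (f + g) p = peval f p + peval g p"
    unfolding fun_cong[OF peval_eq_mono_ext]
    by (rule mono_ext_add) (simp_all add: algebra_simps)
  show "peval (f * g) p = peval f p * peval g p"
    unfolding fun_cong[OF peval_eq_mono_ext]
    by (rule mono_ext_mult) (simp_all add: monom_at_add algebra_simps)
  show "peval 1 p = 1"
    using peval_single[of 0 1 p] by (simp add: monom_at_0)
qed

lemma peval_Const [simp]: "peval (Const c) p = c"
  by (simp add: Const_def peval_single monom_at_0)

lemma peval_Z [simp]: "peval (Z i) p = p $ i"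
  by (simp add: Z_def peval_single monom_at_single)

lemma vector_4 [simp]:
  "(vector [a, b, c, d] :: 'a::zero^4) $ 1 = a" "(vector [a, b, c, d] :: 'a^4) $ 2 = b"
  "(vector [a, b, c, d] :: 'a^4) $ 3 = c" "(vector [a, b, c, d] :: 'a^4) $ 4 = d"
  unfolding vector_def by (simp_all)

lemma monom_at_4:
  "monom_at z m = z $ 1 ^ Poly_Mapping.lookup m 1 * z $ 2 ^ Poly_Mapping.lookup m 2
    * z $ 3 ^ Poly_Mapping.lookup m 3 * z $ (4::4) ^ Poly_Mapping.lookup m 4"
  unfolding monom_at_def UNIV_4 by (simp add: ac_simps)

subsection \<open>The invariant ring and its presentation\<close>

text \<open>The exponent of the character by which the torus scales a monomial; the variable u has
  weight 0.\<close>

definition weight :: "(4 \<Rightarrow>\<^sub>0 nat) \<Rightarrow> int"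
  where "weight n = int (Poly_Mapping.lookup n 1) - int (Poly_Mapping.lookup n 2)
    + int (Poly_Mapping.lookup n 3) - int (Poly_Mapping.lookup n 4)"

interpretation gm_act: ring_hom_fun "gm_act t" for t
  unfolding gm_act_def by (rule ring_hom_lsubst)

lemma gm_act_single:
  assumes t: "t \<noteq> 0"
  shows "gm_act t (Poly_Mapping.single (e, n) c) = Poly_Mapping.single (e, n) (c * t powi weight n)"
proof -
  let ?n = "Poly_Mapping.lookup n"
  have w: "t powi weight n = t ^ ?n 1 * inverse t ^ ?n 2 * t ^ ?n 3 * inverse t ^ ?n 4"
    by (simp only: weight_def power_int_add[OF disjI1[OF t]] power_int_diff[OF disjI1[OF t]]
        power_int_of_nat divide_inverse power_inverse)
  have "gm_act t (Poly_Mapping.single (e, n) c)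
      = Poly_Mapping.single (e, 0) c * Const (t powi weight n) * monom_at (\<chi> i. Y i) n"
    unfolding w gm_act_def lsubst_single monom_at_4
    by (simp only: power_mult_distrib Const_mult Const_power vector_4 fst_conv snd_conv vec_lambda_beta mult.assoc mult.commute mult.left_commute)
  also have "Poly_Mapping.single (e, 0) c * Const (t powi weight n)
      = (Poly_Mapping.single (e, 0) (c * t powi weight n) :: laurent)"
    by (simp add: Const_def mult_single)
  finally show ?thesis by (simp add: monom_at_Y)
qed

lemma lookup_gm_act:
  assumes "t \<noteq> 0"
  shows "Poly_Mapping.lookup (gm_act t f) k = Poly_Mapping.lookup f k * t powi weight (snd k)"
proof (induction f rule: poly_mapping_single_induct)
  case (single m c)
  show ?case
    using gm_act_single[OF assms, of "fst m" "snd m" c] by (simp add: lookup_single when_def)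
qed (simp add: gm_act.add lookup_add distrib_right)

text \<open>Monomials are eigenvectors of the torus, so invariance is decided coefficient by
  coefficient.\<close>

lemma O_R_iff_weight: "f \<in> O_R \<longleftrightarrow> (\<forall>k\<in>Poly_Mapping.keys f. weight (snd k) = 0)"
proof
  assume f: "f \<in> O_R"
  show "\<forall>k\<in>Poly_Mapping.keys f. weight (snd k) = 0"
  proof
    fix k assume "k \<in> Poly_Mapping.keys f"
    then have nz: "Poly_Mapping.lookup f k \<noteq> 0" by (simp add: in_keys_iff)
    \<comment> \<open>A single torus element of infinite order detects the weight. The choice 2 has
      norm different from 1, so strict monotonicity of real powers applies.\<close>
    have "gm_act 2 f = f" using f by (simp add: O_R_def)
    then have "(2::complex) powi weight (snd k) = 1"
      using lookup_gm_act[of 2 f k] nz by simp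
    then have "norm ((2::complex) powi weight (snd k)) = 1" by simp
    then have "(2::real) powi weight (snd k) = 1" by (simp add: norm_power_int)
    then show "weight (snd k) = 0"
      using power_int_strict_increasing[of 0 "weight (snd k)" "2::real"]
        power_int_strict_increasing[of "weight (snd k)" 0 "2::real"]
      by (cases "weight (snd k)" "0::int" rule: linorder_cases) auto
  qed
next
  assume w: "\<forall>k\<in>Poly_Mapping.keys f. weight (snd k) = 0"
  show "f \<in> O_R"
    unfolding O_R_def
  proof (intro CollectI allI impI)
    fix t :: complex assume "t \<noteq> 0"
    moreover have "Poly_Mapping.lookup f k = 0 \<or> weight (snd k) = 0" for k
      using w by (auto simp: in_keys_iff)
    ultimately show "gm_act t f = f"
      by (intro poly_mapping_eqI) (metis lookup_gm_act mult_1_right mult_zero_left power_int_0_right)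
  qed
qed

lemma O_R_add: "f \<in> O_R \<Longrightarrow> g \<in> O_R \<Longrightarrow> f + g \<in> O_R"
  and O_R_mult: "f \<in> O_R \<Longrightarrow> g \<in> O_R \<Longrightarrow> f * g \<in> O_R"
  by (auto simp: O_R_def gm_act.add gm_act.mult)

section \<open>The section on weight-zero monomials\<close>

definition B12 :: laurent where "B12 = Y 3 - 1"
definition B14 :: laurent where "B14 = Y 2 - U ^ 2"
text \<open>Solution of s1 = u a_3 a_2 + (x1 + x2 x3) / u for a_3 a_2. This is the trace formula
  after the summand u has cancelled against the shift u^2 in x1.\<close>

definition B32 :: laurent where "B32 = Y 1 * Uinv - Uinv ^ 2 * (Y 2 + Y 3 * Y 4)"
definition B34 :: laurent where "B34 = Y 4 - 1"

lemma U2_B32: "U ^ 2 * B32 = U * Y 1 - (Y 2 + Y 3 * Y 4)"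
proof -
  \<comment> \<open>The factors \<open>U * Uinv\<close> stay grouped: this is a formal ring
    identity, and the one relation of the Laurent ring is applied afterwards.\<close>
  have "U ^ 2 * B32 = U * (U * Uinv) * Y 1 - (U * Uinv) ^ 2 * (Y 2 + Y 3 * Y 4)"
    by (simp add: B32_def algebra_simps power2_eq_square)
  then show ?thesis by (simp add: U_Uinv)
qed

lemma cubic_total_eq: "cubic_total = U ^ 2 * (B12 * B34 - B14 * B32)"
proof -
  have "U ^ 2 * (B12 * B34 - B14 * B32) = U ^ 2 * B12 * B34 - B14 * (U ^ 2 * B32)"
    by (simp add: algebra_simps)
  also have "\<dots> = cubic_total"
    unfolding U2_B32 B12_def B14_def B34_def cubic_total_def cubic_def
    by (simp add: algebra_simps power2_eq_square power3_eq_cube)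
  finally show ?thesis ..
qed

lemma cubic_total_dvd_relation: "cubic_total dvd B14 * B32 - B12 * B34"
proof
  have "cubic_total * Uinv ^ 2 = (U * Uinv) ^ 2 * (B12 * B34 - B14 * B32)"
    by (simp add: cubic_total_eq power_mult_distrib ac_simps)
  then show "B14 * B32 - B12 * B34 = cubic_total * - (Uinv ^ 2)"
    by (simp add: U_Uinv)
qed

lemma diff_dvd_power_diff: "(x - y :: 'a::comm_ring_1) dvd x ^ n - y ^ n"
proof (cases n)
  case (Suc k)
  then show ?thesis unfolding Suc by (simp only: power_diff_sumr2 dvd_triv_left)
qed simp

definition Bmon :: "nat \<Rightarrow> nat \<Rightarrow> nat \<Rightarrow> nat \<Rightarrow> laurent"
  where "Bmon i j k l = B12 ^ i * B14 ^ j * B32 ^ k * B34 ^ l"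

lemma Bmon_mult: "Bmon i j k l * Bmon i' j' k' l' = Bmon (i + i') (j + j') (k + k') (l + l')"
  by (simp add: Bmon_def power_add ac_simps)

text \<open>The hypotheses compare the exponents of a_1, a_2, a_3, a_4 in this order. Equality
  forces the quadruples (i, j, k, l) to differ by a multiple of (1, -1, -1, 1), that is, by d
  exchanges of \<open>B14 * B32\<close> for \<open>B12 * B34\<close>.\<close>

lemma Bmon_cong:
  assumes "i + j = i' + j'" "i + k = i' + k'" "l + k = l' + k'" "l + j = l' + j'"
  shows "cubic_total dvd Bmon i j k l - Bmon i' j' k' l'"
proof -
  have le: "cubic_total dvd Bmon i (j + d) (k + d) l - Bmon (i + d) j k (l + d)" for i j k l d
  proof -
    have "Bmon i (j + d) (k + d) l - Bmon (i + d) j k (l + d)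
        = ((B14 * B32) ^ d - (B12 * B34) ^ d) * Bmon i j k l"
      by (simp add: Bmon_def power_add power_mult_distrib algebra_simps)
    also have "cubic_total dvd \<dots>"
      by (intro dvd_mult2 dvd_trans[OF cubic_total_dvd_relation diff_dvd_power_diff])
    finally show ?thesis .
  qed
  show ?thesis
  proof (cases "i \<le> i'")
    case True
    then obtain d where "i' = i + d" by (auto simp: le_iff_add)
    then have "j = j' + d" "k = k' + d" "l' = l + d" using assms by auto
    then show ?thesis using \<open>i' = i + d\<close> le by simp
  next
    case False
    then obtain d where "i = i' + d" by (metis le_iff_add nat_le_linear)
    then have "j' = j + d" "k' = k + d" "l = l' + d" using assms by auto
    moreover have "cubic_total dvd - (Bmon i' (j + d) (k + d) l' - Bmon (i' + d) j k (l' + d))"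
      using le by (simp only: dvd_minus_iff)
    ultimately show ?thesis using \<open>i = i' + d\<close> by simp
  qed
qed

text \<open>Greedy pairing: a_1 with a_2 and a_3 with a_4 as far as possible, the excess of a_1 with
  a_4 or that of a_2 with a_3. Truncated subtraction makes one of the two mixed exponents 0. In
  weight 0 the pairing uses up the whole monomial.\<close>

definition Bsec :: "(4 \<Rightarrow>\<^sub>0 nat) \<Rightarrow> laurent"
  where "Bsec n = (let a = Poly_Mapping.lookup n in
    Bmon (min (a 1) (a 2)) (a 1 - a 2) (a 2 - a 1) (min (a 3) (a 4)))"

text \<open>If one monomial has an excess of a_1 and the other an excess of a_2, the product of the
  two pairings is not the greedy one; it still pairs the same monomial, so \<open>Bmon_cong\<close>
  applies.\<close>

lemma Bsec_mult:
  assumes "weight m = 0" "weight n = 0"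
  shows "cubic_total dvd Bsec (m + n) - Bsec m * Bsec n"
  unfolding Bsec_def Let_def Bmon_mult
  by (rule Bmon_cong) (use assms in \<open>auto simp: weight_def lookup_add\<close>)

text \<open>Total on \<open>laurent\<close>, so that additivity holds without side conditions; it
  represents its argument only on invariants.\<close>

definition sec :: "laurent \<Rightarrow> laurent"
  where "sec = mono_ext (\<lambda>k c. Poly_Mapping.single (fst k, 0) c * Bsec (snd k))"

lemma sec_single: "sec (Poly_Mapping.single k c) = Poly_Mapping.single (fst k, 0) c * Bsec (snd k)"
  by (simp add: sec_def mono_ext_single)

lemma sec_add: "sec (f + g) = sec f + sec g"
  unfolding sec_def by (rule mono_ext_add) (simp_all add: single_add distrib_right)

text \<open>Every term of an invariant is invariant, so adding up the terms never leaves
  \<open>O_R\<close>.\<close>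

lemma O_R_induct [consumes 1, case_names single add]:
  assumes f: "f \<in> O_R"
    and single: "\<And>e n c. weight n = 0 \<Longrightarrow> P (Poly_Mapping.single (e, n) c)"
    and add: "\<And>f g. P f \<Longrightarrow> P g \<Longrightarrow> P (f + g)"
  shows "P f"
proof -
  have "P (\<Sum>k\<in>K. Poly_Mapping.single k (Poly_Mapping.lookup f k))"
    if "finite K" "K \<subseteq> Poly_Mapping.keys f" for K
    using that
  proof (induction K rule: finite_induct)
    case empty
    \<comment> \<open>The zero element counts as a weight-zero term with coefficient 0.\<close>
    show ?case using single[of 0 0 0] by (simp add: weight_def)
  next
    case (insert k F)
    have "weight (snd k) = 0" using insert.prems f by (simp add: O_R_iff_weight)
    then have "P (Poly_Mapping.single k (Poly_Mapping.lookup f k))"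
      using single[of "snd k" "fst k"] by simp
    then show ?case using insert by (simp add: add)
  qed
  from this[OF finite_keys[of f]] show ?thesis by (simp flip: poly_mapping_eq_sum_single)
qed

text \<open>The defect of multiplicativity is additive in each argument, so only terms matter, and
  for them it is a scalar times the defect of \<open>Bsec\<close>.\<close>

lemma sec_mult:
  assumes "f \<in> O_R" "g \<in> O_R"
  shows "cubic_total dvd sec (f * g) - sec f * sec g"
  using assms(1)
proof (induction f rule: O_R_induct)
  case (single e n c)
  note n = single
  show ?case
    using assms(2)
  proof (induction g rule: O_R_induct)
    case (single e' n' c')
    have "sec (Poly_Mapping.single (e, n) c * Poly_Mapping.single (e', n') c')
        - sec (Poly_Mapping.single (e, n) c) * sec (Poly_Mapping.single (e', n') c')
        = Poly_Mapping.single (e + e', 0) (c * c') * (Bsec (n + n') - Bsec n * Bsec n')"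
    proof -
      have "Poly_Mapping.single (e + e', 0) (c * c')
          = (Poly_Mapping.single (e, 0) c * Poly_Mapping.single (e', 0) c' :: laurent)"
        by (simp add: mult_single)
      moreover have "Poly_Mapping.single (e, n) c * Poly_Mapping.single (e', n') c'
          = Poly_Mapping.single (e + e', n + n') (c * c')"
        by (simp add: mult_single)
      ultimately show ?thesis
        by (simp only: sec_single fst_conv snd_conv right_diff_distrib ac_simps)
    qed
    then show ?case using Bsec_mult[OF n single] by simp
  next
    case (add g g')
    from dvd_add[OF this] show ?case by (simp add: distrib_left sec_add algebra_simps)
  qed
next
  case (add f f')
  from dvd_add[OF this] show ?case by (simp add: distrib_right sec_add algebra_simps)
qed

text \<open>On invariants, \<open>sec\<close> is a ring homomorphism modulo \<open>cubic_total\<close>; being also linear, it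
  inverts \<open>pres\<close> modulo \<open>cubic_total\<close> as soon as it does so on the generators.\<close>

definition lifts :: "laurent \<Rightarrow> laurent \<Rightarrow> bool"
  where "lifts f F \<longleftrightarrow> f \<in> O_R \<and> cubic_total dvd sec f - F"

lemma lifts_add: "lifts f F \<Longrightarrow> lifts g G \<Longrightarrow> lifts (f + g) (F + G)"
  unfolding lifts_def
  using dvd_add[of cubic_total "sec f - F" "sec g - G"]
  by (auto simp: O_R_add sec_add algebra_simps)

lemma lifts_mult:
  assumes "lifts f F" "lifts g G"
  shows "lifts (f * g) (F * G)"
proof -
  have "sec (f * g) - F * G
      = (sec (f * g) - sec f * sec g) + (sec f * (sec g - G) + (sec f - F) * G)"
    by (simp add: algebra_simps)
  also have "cubic_total dvd \<dots>"
    using assms unfolding lifts_def by (intro dvd_add sec_mult dvd_mult dvd_mult2) auto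
  finally show ?thesis using assms by (simp add: lifts_def O_R_mult)
qed

lemma lifts_single:
  assumes "weight n = 0"
  shows "lifts (Poly_Mapping.single (e, n) c) (Poly_Mapping.single (e, 0) c * Bsec n)"
  using assms by (simp add: lifts_def O_R_iff_weight sec_single)

lemma lifts_scalar: "lifts (Poly_Mapping.single (e, 0) c) (Poly_Mapping.single (e, 0) c)"
  using lifts_single[of 0 e c] by (simp add: weight_def Bsec_def Bmon_def)

lemma lifts_1: "lifts 1 1"
  using lifts_scalar[of 0 1] by simp

text \<open>A product of two variables admits one pairing only, so \<open>Bsec\<close> returns the
  corresponding \<open>B\<close> exactly.\<close>

lemma lifts_quadratic:
  "lifts (Y 1 * Y 2) B12" "lifts (Y 1 * Y 4) B14" "lifts (Y 3 * Y 2) B32" "lifts (Y 3 * Y 4) B34"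
proof -
  have *: "Y i * Y j = Poly_Mapping.single (0, Poly_Mapping.single i 1 + Poly_Mapping.single j 1) 1" for i j
    by (simp add: Y_def mult_single)
  have "lifts (Y i * Y j) (Bsec (Poly_Mapping.single i 1 + Poly_Mapping.single j 1))"
    if "weight (Poly_Mapping.single i 1 + Poly_Mapping.single j 1) = 0" for i j
    using lifts_single[OF that, of 0 1] by (simp add: *)
  from this[of 1 2] this[of 1 4] this[of 3 2] this[of 3 4]
  show "lifts (Y 1 * Y 2) B12" "lifts (Y 1 * Y 4) B14" "lifts (Y 3 * Y 2) B32" "lifts (Y 3 * Y 4) B34"
    by (simp_all add: weight_def lookup_add lookup_single Bsec_def Bmon_def)
qed

lemma trace_2: "trace (M :: 'a::comm_ring_1^2^2) = M $ 1 $ 1 + M $ 2 $ 2"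
  by (simp add: trace_def sum_2)

text \<open>Grouped by quadratic invariants instead of expanded, so that the closure rules of
  \<open>lifts\<close> apply summand by summand.\<close>

lemma tr_top_eq: "tr_top = U + U * (Y 3 * Y 2) + Uinv * (Y 1 * Y 4 + (Y 1 * Y 2 + 1) * (Y 3 * Y 4 + 1))"
  unfolding tr_top_def top_infinity_def trace_2 diag2_def lower2_def upper2_def
  by (simp add: matrix_matrix_mult_def sum_2 algebra_simps)

lemma lifts_generators:
  "lifts tr_top (Y 1)" "lifts x1 (Y 2)" "lifts x2 (Y 3)" "lifts x3 (Y 4)"
proof -
  have U: "lifts U U" and Ui: "lifts Uinv Uinv"
    unfolding U_def Uinv_def by (rule lifts_scalar)+
  note I = lifts_add lifts_mult lifts_quadratic lifts_1 U Ui
  have "lifts x1 (B14 + U ^ 2)" "lifts x2 (B12 + 1)" "lifts x3 (B34 + 1)"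
    unfolding x1_def x2_def x3_def power2_eq_square by (intro I)+
  then show "lifts x1 (Y 2)" "lifts x2 (Y 3)" "lifts x3 (Y 4)"
    by (simp_all add: B14_def B12_def B34_def)
  have "lifts tr_top (U + U * B32 + Uinv * (B14 + (B12 + 1) * (B34 + 1)))"
    unfolding tr_top_eq by (intro I)
  moreover have "U + U * B32 + Uinv * (B14 + (B12 + 1) * (B34 + 1)) = Y 1"
  proof -
    have "U + U * B32 + Uinv * (B14 + (B12 + 1) * (B34 + 1))
        = U + (U * Uinv) * Y 1 - (U * Uinv) * Uinv * (Y 2 + Y 3 * Y 4)
          + Uinv * (Y 2 + Y 3 * Y 4) - (U * Uinv) * U"
      by (simp add: B32_def B14_def B12_def B34_def algebra_simps power2_eq_square)
    then show ?thesis by (simp add: U_Uinv)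
  qed
  ultimately show "lifts tr_top (Y 1)" by simp
qed

interpretation pres: ring_hom_fun pres
  unfolding pres_def by (rule ring_hom_lsubst)

lemma pres_scalar: "pres (Poly_Mapping.single (e, 0) c) = Poly_Mapping.single (e, 0) c"
  by (simp add: pres_def)

lemma pres_U [simp]: "pres U = U" and pres_Uinv [simp]: "pres Uinv = Uinv"
  and pres_Const [simp]: "pres (Const c) = Const c"
  by (simp_all add: pres_def)

lemma pres_Y [simp]: "pres (Y 1) = tr_top" "pres (Y 2) = x1" "pres (Y 3) = x2" "pres (Y 4) = x3"
  by (simp_all add: pres_def)

text \<open>Says two things: \<open>pres\<close> takes values in \<open>O_R\<close>, and
  \<open>sec\<close> inverts it modulo the cubic. The second bounds the kernel, because
  \<open>pres F = 0\<close> leaves \<open>cubic_total dvd F\<close>.\<close>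

lemma lifts_pres: "lifts (pres F) F"
proof (induction F rule: laurent_induct)
  case (scalar e c)
  then show ?case by (simp add: pres_scalar lifts_scalar)
next
  case (Y i)
  have "\<forall>i. lifts (pres (Y i)) (Y i)"
    unfolding forall_4 using lifts_generators by simp
  then show ?case ..
qed (simp_all add: pres.add pres.mult lifts_add lifts_mult)

lemma pres_B: "pres B12 = Y 1 * Y 2" "pres B14 = Y 1 * Y 4" "pres B32 = Y 3 * Y 2" "pres B34 = Y 3 * Y 4"
proof -
  show "pres B12 = Y 1 * Y 2" "pres B14 = Y 1 * Y 4" "pres B34 = Y 3 * Y 4"
    by (simp_all add: B12_def B14_def B34_def pres.simps x1_def x2_def x3_def)
  have "pres B32 = (U * Uinv) * (1 + Y 3 * Y 2) + Uinv ^ 2 * (Y 1 * Y 4 + (Y 1 * Y 2 + 1) * (Y 3 * Y 4 + 1))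
      - Uinv ^ 2 * (Y 1 * Y 4 + (Y 1 * Y 2 + 1) * (Y 3 * Y 4 + 1)) - (U * Uinv) ^ 2"
    by (simp add: B32_def pres.simps x1_def x2_def x3_def tr_top_eq algebra_simps power2_eq_square)
  then show "pres B32 = Y 3 * Y 2" by (simp add: U_Uinv)
qed

text \<open>In this order the composite is exactly the identity, because \<open>pres\<close> turns
  each \<open>B\<close> back into its product a_i a_j; surjectivity of \<open>pres\<close> onto the
  invariants follows.\<close>

lemma pres_sec:
  assumes "g \<in> O_R"
  shows "pres (sec g) = g"
  using assms
proof (induction g rule: O_R_induct)
  case (single e n c)
  let ?n = "Poly_Mapping.lookup n"
  define i j k l where "i = min (?n 1) (?n 2)" and "j = ?n 1 - ?n 2" and "k = ?n 2 - ?n 1"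
    and "l = min (?n 3) (?n 4)"
  \<comment> \<open>Weight 0 enters in the last two equations: the excess of a_1 over a_2 equals
    that of a_4 over a_3.\<close>
  have n: "?n 1 = i + j" "?n 2 = i + k" "?n 3 = l + k" "?n 4 = l + j"
    using single by (auto simp: i_def j_def k_def l_def weight_def)
  have "pres (Bsec n) = monom_at (\<chi> i. Y i) n"
    unfolding Bsec_def Let_def i_def[symmetric] j_def[symmetric] k_def[symmetric] l_def[symmetric]
    by (simp add: Bmon_def pres.simps pres_B monom_at_4 n power_add power_mult_distrib ac_simps)
  then show ?case
    by (simp add: sec_single pres.mult pres_scalar monom_at_Y)
qed (simp add: sec_add pres.add)

lemma pres_cubic_total: "pres cubic_total = 0"
  by (simp add: cubic_total_eq pres.simps pres_B)

lemma range_pres: "range pres = O_R"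
  proof
  show "range pres \<subseteq> O_R" using lifts_pres by (auto simp: lifts_def)
  show "O_R \<subseteq> range pres" using pres_sec by (metis rangeI subsetI)
qed

lemma pres_eq_0_iff: "pres f = 0 \<longleftrightarrow> cubic_total dvd f"
proof
  assume "pres f = 0"
  moreover have "sec 0 = 0" by (simp add: sec_def mono_ext_def)
  ultimately show "cubic_total dvd f"
    using lifts_pres[of f] by (simp add: lifts_def)
next
  assume "cubic_total dvd f"
  then show "pres f = 0" by (auto simp: dvd_def pres.mult pres_cubic_total)
qed

subsection \<open>The coordinate rings of the fibres\<close>

text \<open>Inclusion of C[x1, x2, x3] in the ambient ring; the index shifts by one because
  \<open>Y 1\<close> is s1.\<close>

definition \<iota> :: "poly3 \<Rightarrow> laurent"
  where "\<iota> = psubst (vector [Y 2, Y 3, Y 4])"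

interpretation \<iota>: ring_hom_fun \<iota>
  unfolding \<iota>_def by (rule psubst.ring_hom_fun_axioms)

lemma \<iota>_Const [simp]: "\<iota> (Const c) = Const c"
  by (simp add: \<iota>_def)

lemma \<iota>_Z [simp]: "\<iota> (Z 1) = Y 2" "\<iota> (Z 2) = Y 3" "\<iota> (Z 3) = Y 4"
  by (simp_all add: \<iota>_def)

lemma pres_\<iota>: "pres (\<iota> g) = psubst (vector [x1, x2, x3]) g"
proof (induction g rule: poly3_induct)
  case (Z i)
  have "\<forall>i. pres (\<iota> (Z i)) = psubst (vector [x1, x2, x3]) (Z i)"
    unfolding forall_3 by simp
  then show ?case ..
qed (simp_all add: \<iota>.simps pres.simps psubst.simps)

text \<open>Restriction of ambient functions to fixed values of s1 and s2, a left inverse of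
  \<open>\<iota>\<close> when the value of s2 is nonzero.\<close>

definition specialize :: "complex \<Rightarrow> complex \<Rightarrow> laurent \<Rightarrow> poly3"
  where "specialize s1 s2 = mono_ext (\<lambda>k c.
    Const (c * s2 powi fst k) * monom_at (vector [Const s1, Z 1, Z 2, Z 3]) (snd k))"

lemma specialize_single: "specialize s1 s2 (Poly_Mapping.single k c)
    = Const (c * s2 powi fst k) * monom_at (vector [Const s1, Z 1, Z 2, Z 3]) (snd k)"
  by (simp add: specialize_def mono_ext_single Const_0)

lemma ring_hom_specialize:
  assumes "s2 \<noteq> 0"
  shows "ring_hom_fun (specialize s1 s2)"
proof
  fix f g :: laurent
  show "specialize s1 s2 (f + g) = specialize s1 s2 f + specialize s1 s2 g"
    unfolding specialize_def
    by (rule mono_ext_add) (simp_all add: Const_0 Const_add distrib_right)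
  have c: "Const (a * (b * s2 powi (k + l))) = (Const (a * s2 powi k) * Const (b * s2 powi l) :: poly3)"
    for a b k l
    using assms by (simp add: power_int_add ac_simps flip: Const_mult)
  show "specialize s1 s2 (f * g) = specialize s1 s2 f * specialize s1 s2 g"
    unfolding specialize_def
    by (rule mono_ext_mult)
       (simp_all only: mult_zero_left Const_0 Const_add distrib_right c fst_add snd_add monom_at_add mult.assoc
          mult.left_commute)
  show "specialize s1 s2 1 = 1"
    using specialize_single[of s1 s2 0 1] by (simp add: monom_at_0 Const_1)
qed

lemma specialize_scalar [simp]:
  "specialize s1 s2 (Poly_Mapping.single (e, 0) c) = Const (c * s2 powi e)"
  by (simp add: specialize_single monom_at_0)

lemma specialize_Const [simp]: "specialize s1 s2 (Const c) = Const c"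
  using specialize_scalar[of s1 s2 0 c] by (simp add: Const_def)

lemma specialize_U [simp]: "specialize s1 s2 U = Const s2"
  by (simp add: U_def)

lemma specialize_Y [simp]:
  "specialize s1 s2 (Y 1) = Const s1" "specialize s1 s2 (Y 2) = Z 1"
  "specialize s1 s2 (Y 3) = Z 2" "specialize s1 s2 (Y 4) = Z 3"
  by (simp_all add: Y_def specialize_single monom_at_single Const_1)

lemma specialize_\<iota>:
  assumes "s2 \<noteq> 0"
  shows "specialize s1 s2 (\<iota> g) = g"
proof -
  interpret ring_hom_fun "specialize s1 s2" by (rule ring_hom_specialize[OF assms])
  show ?thesis
  proof (induction g rule: poly3_induct)
    case (Z i)
    have "\<forall>i. specialize s1 s2 (\<iota> (Z i)) = Z i"
      unfolding forall_3 by simp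
    then show ?case ..
  qed (simp_all add: \<iota>.simps simps)
qed

text \<open>Congruence modulo the ideal of the base point, taken in the ambient ring and not in
  \<open>O_R\<close>: there \<open>specialize\<close> is available.\<close>

definition base_cong :: "complex \<Rightarrow> complex \<Rightarrow> laurent \<Rightarrow> laurent \<Rightarrow> bool"
  where "base_cong s1 s2 F G \<longleftrightarrow>
    (\<exists>a b. F - G = (Y 1 - Const s1) * a + (U - Const s2) * b)"

lemma base_cong_refl: "base_cong s1 s2 F F"
  unfolding base_cong_def by (rule exI[of _ 0], rule exI[of _ 0]) simp

lemma base_cong_add:
  assumes "base_cong s1 s2 F G" "base_cong s1 s2 F' G'"
  shows "base_cong s1 s2 (F + F') (G + G')"
proof -
  obtain a b a' b' where
    "F - G = (Y 1 - Const s1) * a + (U - Const s2) * b"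
    "F' - G' = (Y 1 - Const s1) * a' + (U - Const s2) * b'"
    using assms unfolding base_cong_def by blast
  then have "(F - G) + (F' - G') = (Y 1 - Const s1) * (a + a') + (U - Const s2) * (b + b')"
    by (simp only: distrib_left distrib_right ac_simps)
  then show ?thesis unfolding base_cong_def by (metis add_diff_add)
qed

lemma base_cong_mult:
  assumes "base_cong s1 s2 F G" "base_cong s1 s2 F' G'"
  shows "base_cong s1 s2 (F * F') (G * G')"
proof -
  obtain a b a' b' where
    *: "F - G = (Y 1 - Const s1) * a + (U - Const s2) * b"
    "F' - G' = (Y 1 - Const s1) * a' + (U - Const s2) * b'"
    using assms unfolding base_cong_def by blast
  have "F * F' - G * G' = (F - G) * F' + G * (F' - G')"
    by (simp add: algebra_simps)
  also have "\<dots> = (Y 1 - Const s1) * (a * F' + G * a') + (U - Const s2) * (b * F' + G * b')"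
    unfolding * by (simp only: distrib_left distrib_right ac_simps)
  finally show ?thesis unfolding base_cong_def by blast
qed

lemma base_cong_scalar:
  assumes "s2 \<noteq> 0"
  shows "base_cong s1 s2 (Poly_Mapping.single (e, 0) c) (Const (c * s2 powi e))"
proof -
  have U: "base_cong s1 s2 U (Const s2)"
    unfolding base_cong_def by (rule exI[of _ 0], rule exI[of _ 1]) simp
  \<comment> \<open>The identity 1/u - 1/c = -(u - c) / (c u) places the difference in the ideal;
    negative powers of u then follow by induction.\<close>
  have "Uinv - Const (inverse s2) = Const (s2 * inverse s2) * Uinv - Const (inverse s2) * (U * Uinv)"
    using assms by (simp add: U_Uinv Const_1)
  also have "\<dots> = (U - Const s2) * (- Const (inverse s2) * Uinv)"
    by (simp only: Const_mult) (simp add: algebra_simps)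
  finally have Ui: "base_cong s1 s2 Uinv (Const (inverse s2))"
    unfolding base_cong_def
    by (intro exI[of _ 0] exI[of _ "- Const (inverse s2) * Uinv"]) simp
  have "base_cong s1 s2 (Poly_Mapping.single (e, 0) 1) (Const (s2 powi e))"
  proof (induction e rule: int_induct[where k = 0])
    case base
    show ?case by (simp add: Const_1 base_cong_refl)
  next
    case (step1 i)
    show ?case
      using base_cong_mult[OF step1(2) U] assms
      by (simp add: U_def mult_single power_int_add flip: Const_mult)
  next
    case (step2 i)
    show ?case
      using base_cong_mult[OF step2(2) Ui] assms
      by (simp add: Uinv_def mult_single power_int_diff divide_inverse flip: Const_mult)
  qed
  from base_cong_mult[OF base_cong_refl[of s1 s2 "Const c"] this] show ?thesis
    by (simp add: Const_mult) (simp add: Const_def mult_single)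
qed

text \<open>Congruences add and multiply, so the generators suffice. It shows that an element killed
  by \<open>specialize\<close> lies in the ideal of the base point.\<close>

lemma base_cong_specialize:
  assumes "s2 \<noteq> 0"
  shows "base_cong s1 s2 F (\<iota> (specialize s1 s2 F))"
proof -
  interpret ring_hom_fun "specialize s1 s2" by (rule ring_hom_specialize[OF assms])
  show ?thesis
  proof (induction F rule: laurent_induct)
    case (scalar e c)
    show ?case using base_cong_scalar[OF assms] by simp
  next
    case (Y i)
    have "base_cong s1 s2 (Y 1) (Const s1)"
      unfolding base_cong_def by (rule exI[of _ 1], rule exI[of _ 0]) simp
    then have "\<forall>i. base_cong s1 s2 (Y i) (\<iota> (specialize s1 s2 (Y i)))"
      unfolding forall_4 by (simp add: base_cong_refl)
    then show ?case ..
  qed (simp_all add: \<iota>.simps simps base_cong_add base_cong_mult)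
qed

text \<open>Surjectivity of \<open>pres\<close> lifts the two invariant multipliers, which moves the
  fibre ideal to the ambient ring.\<close>

lemma fibre_ideal_eq: "fibre_ideal s1 s2 = {pres H | H. base_cong s1 s2 H 0}"
proof (intro set_eqI iffI)
  fix h assume "h \<in> fibre_ideal s1 s2"
  then obtain F G where "h = (tr_top - Const s1) * pres F + (U - Const s2) * pres G"
    unfolding fibre_ideal_def range_pres[symmetric] by blast
  then have "h = pres ((Y 1 - Const s1) * F + (U - Const s2) * G)"
    by (simp add: pres.simps)
  then show "h \<in> {pres H | H. base_cong s1 s2 H 0}"
    unfolding base_cong_def by force
next
  fix h assume "h \<in> {pres H | H. base_cong s1 s2 H 0}"
  then obtain a b where "h = pres ((Y 1 - Const s1) * a + (U - Const s2) * b)"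
    unfolding base_cong_def by force
  then have "h = (tr_top - Const s1) * pres a + (U - Const s2) * pres b"
    by (simp add: pres.simps)
  then show "h \<in> fibre_ideal s1 s2"
    unfolding fibre_ideal_def range_pres[symmetric] by blast
qed

lemma fibre_coordinates:
  assumes "s2 \<noteq> 0" "f \<in> O_R"
  shows "\<exists>g. f - psubst (vector [x1, x2, x3]) g \<in> fibre_ideal s1 s2"
proof -
  obtain F where F: "f = pres F" using assms(2) unfolding range_pres[symmetric] by blast
  have "base_cong s1 s2 (F - \<iota> (specialize s1 s2 F)) 0"
    using base_cong_specialize[OF assms(1), of s1 F] by (simp add: base_cong_def)
  moreover have "f - psubst (vector [x1, x2, x3]) (specialize s1 s2 F)
      = pres (F - \<iota> (specialize s1 s2 F))"
    by (simp add: F pres.diff pres_\<iota>)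
  ultimately show ?thesis unfolding fibre_ideal_eq by blast
qed

text \<open>If \<open>\<iota> g\<close> and some H in the ideal of the base point have the same
  image under \<open>pres\<close>, they differ by a multiple of \<open>cubic_total\<close>;
  \<open>specialize\<close> kills H and sends that multiple to one of
  \<open>cubic_fibre\<close>.\<close>

lemma ideal_fibre_eq:
  assumes "s2 \<noteq> 0"
  shows "ideal_fibre s1 s2 = {g. cubic_fibre s1 s2 dvd g}"
proof -
  interpret sp: ring_hom_fun "specialize s1 s2" by (rule ring_hom_specialize[OF assms])
  have sp_cubic: "specialize s1 s2 cubic_total = cubic_fibre s1 s2"
    by (simp add: cubic_total_def cubic_fibre_def sp.cubic)
  have sp_0: "specialize s1 s2 H = 0" if "base_cong s1 s2 H 0" for H
    using that by (auto simp: base_cong_def sp.simps)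
  show ?thesis
  proof (intro set_eqI iffI CollectI)
    fix g assume "g \<in> ideal_fibre s1 s2"
    then obtain H where H: "pres (\<iota> g) = pres H" "base_cong s1 s2 H 0"
      by (auto simp: ideal_fibre_def fibre_ideal_eq pres_\<iota>)
    then have "cubic_total dvd \<iota> g - H"
      by (simp add: pres.diff flip: pres_eq_0_iff)
    then obtain K where "\<iota> g - H = cubic_total * K" by (rule dvdE)
    then have "specialize s1 s2 (\<iota> g - H) = cubic_fibre s1 s2 * specialize s1 s2 K"
      by (simp add: sp.mult sp_cubic)
    then show "cubic_fibre s1 s2 dvd g"
      by (simp add: sp.diff sp_0[OF H(2)] specialize_\<iota>[OF assms])
  next
    fix g assume "g \<in> {g. cubic_fibre s1 s2 dvd g}"
    then obtain k where g: "g = cubic_fibre s1 s2 * k" by (auto simp: dvd_def)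
    \<comment> \<open>This H differs from \<open>\<iota> g\<close> by a multiple of
      \<open>cubic_total\<close>, which \<open>pres\<close> kills, and its first factor vanishes at
      the base point.\<close>
    let ?H = "(\<iota> (cubic_fibre s1 s2) - cubic_total) * \<iota> k"
    have "pres (\<iota> g) = pres ?H"
      by (simp add: g \<iota>.mult pres.simps pres_cubic_total)
    moreover have "base_cong s1 s2 ?H 0"
    proof -
      obtain a b where "cubic_total - \<iota> (cubic_fibre s1 s2)
          = (Y 1 - Const s1) * a + (U - Const s2) * b"
        using base_cong_specialize[OF assms, of s1 cubic_total]
        unfolding sp_cubic base_cong_def by blast
      then have "?H = - ((Y 1 - Const s1) * a + (U - Const s2) * b) * \<iota> k"
        by (metis minus_diff_eq)
      also have "\<dots> = (Y 1 - Const s1) * (- a * \<iota> k) + (U - Const s2) * (- b * \<iota> k)"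
        by (simp add: algebra_simps)
      finally show ?thesis unfolding base_cong_def diff_zero by blast
    qed
    ultimately show "g \<in> ideal_fibre s1 s2"
      by (auto simp: ideal_fibre_def fibre_ideal_eq pres_\<iota>)
  qed
qed

section \<open>Total degree of the fibre equations\<close>

definition degree_le :: "nat \<Rightarrow> poly3 \<Rightarrow> bool"
  where "degree_le d g \<longleftrightarrow>
    (\<forall>m\<in>Poly_Mapping.keys g. (\<Sum>i\<in>UNIV. Poly_Mapping.lookup m i) \<le> d)"

lemma degree_le_mono: "degree_le d g \<Longrightarrow> d \<le> e \<Longrightarrow> degree_le e g"
  by (auto simp: degree_le_def)

lemma degree_le_add: "degree_le d f \<Longrightarrow> degree_le d g \<Longrightarrow> degree_le d (f + g)"
  using keys_add[of f g] by (auto simp: degree_le_def)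

lemma degree_le_uminus: "degree_le d g \<Longrightarrow> degree_le d (- g)"
  by (auto simp: degree_le_def in_keys_iff)

lemma degree_le_diff: "degree_le d f \<Longrightarrow> degree_le d g \<Longrightarrow> degree_le d (f - g)"
  using degree_le_add[of d f "- g"] by (simp add: degree_le_uminus)

lemma degree_le_mult: "degree_le d f \<Longrightarrow> degree_le e g \<Longrightarrow> degree_le (d + e) (f * g)"
  using keys_mult[of f g] by (fastforce simp: degree_le_def lookup_add sum.distrib intro: add_mono)

lemma degree_le_Const: "degree_le 0 (Const c)"
  by (auto simp: degree_le_def Const_def split: if_splits)

lemma degree_le_Z: "degree_le 1 (Z i)"
  by (auto simp: degree_le_def Z_def lookup_single when_def)

text \<open>The term x1 x2 x3 has coefficient 1 for all s1 and s2, and the remainder of degree at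
  most 2 cannot cancel it.\<close>

lemma total_degree_cubic_fibre: "total_degree (cubic_fibre s1 s2) = 3"
proof -
  define R where "R = Z 1 * Z 1 - Const (s2^2 + s1 * s2) * Z 1 - Const (s2^2) * Z 2
    - Const (s2^2) * Z 3 + Const (s2^2 + s1 * s2^3)"
  have eq: "cubic_fibre s1 s2 = Z 1 * Z 2 * Z 3 + R"
    by (simp add: cubic_fibre_def cubic_def R_def Const_add Const_mult Const_power power2_eq_square
        algebra_simps)
  have Z: "degree_le 2 (Const c * Z i)" "degree_le 2 (Const c)" "degree_le 2 (Z i * Z j)" for c i j
    using degree_le_mono[OF degree_le_mult[OF degree_le_Const degree_le_Z], of 2 c i]
      degree_le_mono[OF degree_le_Const, of 2 c]
      degree_le_mono[OF degree_le_mult[OF degree_le_Z degree_le_Z], of 2 i j] by simp_all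
  have R: "degree_le 2 R"
    unfolding R_def by (intro degree_le_add degree_le_diff Z)
  have "degree_le 3 (Z 1 * Z 2 * Z 3)"
    using degree_le_mult[OF Z(3) degree_le_Z] by simp
  then have le: "degree_le 3 (cubic_fibre s1 s2)"
    unfolding eq using degree_le_mono[OF R] by (simp add: degree_le_add)
  let ?m = "Poly_Mapping.single 1 1 + Poly_Mapping.single 2 1 + Poly_Mapping.single 3 1 :: 3 \<Rightarrow>\<^sub>0 nat"
  have m: "(\<Sum>i\<in>UNIV. Poly_Mapping.lookup ?m i) = 3"
    by (simp add: sum_3 lookup_add lookup_single)
  have "Poly_Mapping.lookup R ?m = 0"
    using R m by (force simp: degree_le_def in_keys_iff)
  moreover have "Z 1 * Z 2 * Z 3 = Poly_Mapping.single ?m 1"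
    by (simp add: Z_def mult_single)
  ultimately have "?m \<in> Poly_Mapping.keys (cubic_fibre s1 s2)"
    by (simp add: eq in_keys_iff lookup_add)
  then show ?thesis
    unfolding total_degree_def
    by (intro Max_eqI) (use le m in \<open>auto simp: degree_le_def intro!: rev_image_eqI\<close>)
qed

subsection \<open>Singular loci\<close>

text \<open>By the product rule, F h has zero differential wherever F and dF vanish, so one
  generator decides. Agreement with F is asked only on the open set M: the formula for
  \<open>leval cubic_total\<close> is available only where s2 is nonzero.\<close>

lemma hypersurface_singular_locus_principal:
  fixes F :: "'a::real_normed_vector \<Rightarrow> complex"
  assumes M: "open M" and f0: "f0 \<in> I" "\<And>p. p \<in> M \<Longrightarrow> f0 p = F p"
    and I: "\<And>f. f \<in> I \<Longrightarrow> \<exists>h. (\<forall>p\<in>M. f p = F p * h p \<and> h differentiable at p)"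
  shows "hypersurface_singular_locus M I = {p\<in>M. F p = 0 \<and> (F has_derivative (\<lambda>_. 0)) (at p)}"
proof (intro set_eqI iffI)
  fix p assume "p \<in> hypersurface_singular_locus M I"
  then have p: "p \<in> M" "f0 p = 0" "(f0 has_derivative (\<lambda>_. 0)) (at p)"
    using f0(1) by (auto simp: hypersurface_singular_locus_def)
  then have "(F has_derivative (\<lambda>_. 0)) (at p)"
    using has_derivative_transform_within_open[OF p(3) M p(1) f0(2)] by blast
  then show "p \<in> {p\<in>M. F p = 0 \<and> (F has_derivative (\<lambda>_. 0)) (at p)}"
    using p f0(2) by auto
next
  fix p assume "p \<in> {p\<in>M. F p = 0 \<and> (F has_derivative (\<lambda>_. 0)) (at p)}"
  then have p: "p \<in> M" "F p = 0" "(F has_derivative (\<lambda>_. 0)) (at p)" by auto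
  have "f p = 0 \<and> (f has_derivative (\<lambda>_. 0)) (at p)" if f: "f \<in> I" for f
  proof -
    obtain h where h: "\<And>p. p \<in> M \<Longrightarrow> f p = F p * h p" "\<And>p. p \<in> M \<Longrightarrow> h differentiable at p"
      using I[OF f] by meson
    obtain h' where "(h has_derivative h') (at p)"
      using h(2)[OF p(1)] by (auto simp: differentiable_def)
    from has_derivative_mult[OF p(3) this]
    have "((\<lambda>x. F x * h x) has_derivative (\<lambda>_. 0)) (at p)" by (simp add: p(2))
    from has_derivative_transform_within_open[OF this M p(1)]
    show ?thesis using h(1) p(1,2) by simp
  qed
  then show "p \<in> hypersurface_singular_locus M I"
    using p(1) by (simp add: hypersurface_singular_locus_def)
qed

text \<open>All five arguments vary, so the same formula serves the total space and, with the first
  two constant, the fibres.\<close>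

lemma has_derivative_cubic:
  assumes "(a has_derivative a') (at p)" "(b has_derivative b') (at p)" "(c has_derivative c') (at p)"
    "(d has_derivative d') (at p)" "(e has_derivative e') (at p)"
  shows "((\<lambda>q. cubic (a q) (b q) (c q) (d q) (e q) :: complex) has_derivative
    (\<lambda>v. (b p ^ 3 - b p * c p) * a' v
      + (3 * a p * b p ^ 2 + 2 * b p - (2 * b p + a p) * c p - 2 * b p * d p - 2 * b p * e p) * b' v
      + (d p * e p + 2 * c p - (b p ^ 2 + a p * b p)) * c' v
      + (c p * e p - b p ^ 2) * d' v + (c p * d p - b p ^ 2) * e' v)) (at p)"
  unfolding cubic_def
  by (rule derivative_eq_intros assms refl)+
     (simp add: fun_eq_iff algebra_simps power2_eq_square power3_eq_cube)

lemma differentiable_vec_nth: "f differentiable at x \<Longrightarrow> (\<lambda>x. f x $ i) differentiable at x"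
  unfolding differentiable_def using bounded_linear.has_derivative[OF bounded_linear_vec_nth] by blast

lemma differentiable_prod:
  fixes f :: "'i \<Rightarrow> 'a::real_normed_vector \<Rightarrow> complex"
  assumes "\<And>i. i \<in> I \<Longrightarrow> f i differentiable at p"
  shows "(\<lambda>q. \<Prod>i\<in>I. f i q) differentiable at p"
  using assms by (induction I rule: infinite_finite_induct) simp_all

lemma differentiable_monom_at:
  fixes z :: "'a::real_normed_vector \<Rightarrow> complex^'n::finite"
  assumes "z differentiable at p"
  shows "(\<lambda>q. monom_at (z q) m) differentiable at p"
  unfolding monom_at_def
  by (intro differentiable_prod differentiable_power differentiable_vec_nth assms)

lemma differentiable_leval:
  assumes "fst p \<noteq> 0"
  shows "leval f differentiable at p"
proof -
  have "(fst :: complex \<times> (complex^4) \<Rightarrow> _) differentiable at p" "(snd :: complex \<times> (complex^4) \<Rightarrow> _) differentiable at p"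
    using bounded_linear_fst bounded_linear_snd
    by (auto intro: bounded_linear_imp_differentiable)
  then show ?thesis
    unfolding leval_def[abs_def] using assms
    by (intro differentiable_sum ballI differentiable_mult differentiable_const
        differentiable_power_int differentiable_monom_at) auto
qed

lemma differentiable_peval: "peval g differentiable at p"
  unfolding peval_def[abs_def]
  by (intro differentiable_sum ballI differentiable_mult differentiable_const
        differentiable_monom_at differentiable_ident) auto

lemma peval_cubic_fibre: "peval (cubic_fibre s1 s2) p = cubic s1 s2 (p $ 1) (p $ 2) (p $ 3)"
  by (simp add: cubic_fibre_def peval.cubic)

lemma leval_cubic_total:
  assumes "fst p \<noteq> 0"
  shows "leval cubic_total p = cubic (snd p $ 1) (fst p) (snd p $ 2) (snd p $ 3) (snd p $ 4)"
proof -
  interpret ring_hom_fun "\<lambda>f. leval f p" by (rule ring_hom_leval[OF assms])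
  show ?thesis by (simp add: cubic_total_def cubic)
qed

lemma sing_fibre_iff_gradient:
  assumes s2: "s2 \<noteq> 0"
  shows "p \<in> sing_fibre s1 s2 \<longleftrightarrow> cubic s1 s2 (p $ 1) (p $ 2) (p $ 3) = 0 \<and>
    p $ 2 * p $ 3 + 2 * p $ 1 = s2^2 + s1 * s2 \<and> p $ 1 * p $ 3 = s2^2 \<and> p $ 1 * p $ 2 = s2^2"
proof -
  let ?F = "\<lambda>p::complex^3. cubic s1 s2 (p $ 1) (p $ 2) (p $ 3)"
  have nth: "((\<lambda>p::complex^3. p $ i) has_derivative (\<lambda>p. p $ i)) (at p)" for i
    by (rule bounded_linear.has_derivative[OF bounded_linear_vec_nth has_derivative_ident])
  define D where "D v = (p $ 2 * p $ 3 + 2 * p $ 1 - (s2^2 + s1 * s2)) * v $ 1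
      + (p $ 1 * p $ 3 - s2^2) * v $ 2 + (p $ 1 * p $ 2 - s2^2) * v $ 3" for v :: "complex^3"
  have D: "(?F has_derivative D) (at p)"
    using has_derivative_cubic[OF has_derivative_const[of s1] has_derivative_const[of s2] nth[of 1] nth[of 2] nth[of 3]]
    by (simp add: D_def[abs_def])
  have "D = (\<lambda>_. 0) \<longleftrightarrow> p $ 2 * p $ 3 + 2 * p $ 1 = s2^2 + s1 * s2 \<and> p $ 1 * p $ 3 = s2^2 \<and> p $ 1 * p $ 2 = s2^2"
  proof
    assume "D = (\<lambda>_. 0)"
    then have "D (vector [1, 0, 0]) = 0" "D (vector [0, 1, 0]) = 0" "D (vector [0, 0, 1]) = 0" by auto
    then show "p $ 2 * p $ 3 + 2 * p $ 1 = s2^2 + s1 * s2 \<and> p $ 1 * p $ 3 = s2^2 \<and> p $ 1 * p $ 2 = s2^2"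
      by (simp add: D_def)
  qed (simp add: D_def fun_eq_iff)
  moreover have "(?F has_derivative (\<lambda>_. 0)) (at p) \<longleftrightarrow> D = (\<lambda>_. 0)"
    using D has_derivative_unique by blast
  moreover have "sing_fibre s1 s2 = {p\<in>UNIV. ?F p = 0 \<and> (?F has_derivative (\<lambda>_. 0)) (at p)}"
    unfolding sing_fibre_def
  proof (rule hypersurface_singular_locus_principal)
    show "peval (cubic_fibre s1 s2) \<in> peval ` ideal_fibre s1 s2"
      by (simp add: ideal_fibre_eq[OF s2])
    fix f assume "f \<in> peval ` ideal_fibre s1 s2"
    then obtain h where "f = peval (cubic_fibre s1 s2 * h)"
      by (auto simp: ideal_fibre_eq[OF s2] dvd_def)
    then show "\<exists>h. \<forall>p\<in>UNIV. f p = ?F p * h p \<and> h differentiable at p"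
      by (intro exI[of _ "peval h"]) (simp add: peval.mult peval_cubic_fibre differentiable_peval)
  qed (simp_all add: peval_cubic_fibre)
  ultimately show ?thesis by simp
qed

text \<open>The gradient gives x y = x z = s2^2, hence y = z; eliminating s1 and s2 turns the cubic
  into x (1 - y)^2 (y - x). The factor 1 - y yields the reducible point, the factor y - x the points
  with s1 = 2 or s1 = -2. The alternatives may overlap.\<close>

lemma sing_fibre_iff:
  assumes s2: "s2 \<noteq> 0"
  shows "p \<in> sing_fibre s1 s2 \<longleftrightarrow>
    p = vector [s2^2, 1, 1] \<and> s2^2 - s1 * s2 + 1 = 0 \<or>
    p = vector [s2, s2, s2] \<and> s1 = 2 \<or> p = vector [- s2, - s2, - s2] \<and> s1 = -2"
proof -
  obtain x y z where p: "p = vector [x, y, z]"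
    using that[of "p $ 1" "p $ 2" "p $ 3"] by (simp add: vec_eq_iff forall_3)
  have eq: "vector [x, y, z] = (vector [a, b, c] :: complex^3) \<longleftrightarrow> x = a \<and> y = b \<and> z = c" for a b c
    by (auto simp: vec_eq_iff forall_3)
  show ?thesis
    unfolding sing_fibre_iff_gradient[OF s2] p vector_3 eq
  proof (intro iffI)
    assume *: "cubic s1 s2 x y z = 0 \<and> y * z + 2 * x = s2^2 + s1 * s2 \<and> x * z = s2^2 \<and> x * y = s2^2"
    then have x: "x \<noteq> 0" using s2 by auto
    moreover have "x * z = x * y" using * by metis
    ultimately have z: "z = y" by (metis mult_left_cancel)
    have f: "cubic s1 s2 x y y = 0" and e: "s1 * s2 = y * y + 2 * x - s2^2" and xy: "s2^2 = x * y"
      using * z by auto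
    have "cubic s1 s2 x y y = x * y * y + x^2 - (s2^2 + s1 * s2) * x - 2 * s2^2 * y + s2^2 + s1 * s2 * s2^2"
      by (simp add: cubic_def algebra_simps power2_eq_square power3_eq_cube)
    also have "\<dots> = x * (1 - y)^2 * (y - x)"
      unfolding e xy by (simp add: algebra_simps power2_eq_square)
    finally have "y = 1 \<or> y = x" using f x by auto
    then show "(x = s2^2 \<and> y = 1 \<and> z = 1) \<and> s2^2 - s1 * s2 + 1 = 0 \<or>
      (x = s2 \<and> y = s2 \<and> z = s2) \<and> s1 = 2 \<or> (x = - s2 \<and> y = - s2 \<and> z = - s2) \<and> s1 = -2"
    proof
      assume "y = 1"
      then show ?thesis using xy e z by auto
    next
      assume y: "y = x"
      have "x^2 = s2^2" unfolding xy y by (rule power2_eq_square)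
      then have "x = s2 \<or> x = - s2" by (simp add: power2_eq_iff)
      moreover have "s1 * s2 = 2 * x" using e xy y by simp
      ultimately have "x = s2 \<and> s1 = 2 \<or> x = - s2 \<and> s1 = -2"
        using s2 by (metis mult_minus_left mult_minus_right mult_right_cancel)
      then show ?thesis using y z by blast
    qed
  qed (auto simp: cubic_def algebra_simps power2_eq_square power3_eq_cube; algebra)
qed

lemma sing_R_eq:
  "sing_R = {(s2, vector [s1, s2^2, 1, 1]) | s1 s2. s2 \<noteq> 0 \<and> s1 = s2 + inverse s2}"
proof -
  let ?F = "\<lambda>p::complex \<times> (complex^4). cubic (snd p $ 1) (fst p) (snd p $ 2) (snd p $ 3) (snd p $ 4)"
  let ?M = "{p::complex \<times> (complex^4). fst p \<noteq> 0}"
  have M: "open ?M"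
    by (intro open_Collect_neq continuous_intros)
  have sing: "sing_R = {p\<in>?M. ?F p = 0 \<and> (?F has_derivative (\<lambda>_. 0)) (at p)}"
    unfolding sing_R_def
  proof (rule hypersurface_singular_locus_principal[OF M])
    show "leval cubic_total \<in> leval ` ideal_R"
      by (simp add: ideal_R_def pres_cubic_total)
    show "leval cubic_total p = ?F p" if "p \<in> ?M" for p
      using that by (simp add: leval_cubic_total)
    fix f assume "f \<in> leval ` ideal_R"
    then obtain h where f: "f = leval (cubic_total * h)"
      by (auto simp: ideal_R_def pres_eq_0_iff dvd_def)
    have "f p = ?F p * leval h p \<and> leval h differentiable at p" if "p \<in> ?M" for p
      using that ring_hom_fun.mult[OF ring_hom_leval, of p cubic_total h]
      by (simp add: f leval_cubic_total differentiable_leval)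
    then show "\<exists>h. \<forall>p\<in>?M. f p = ?F p * h p \<and> h differentiable at p" by blast
  qed
  have iff: "(u, vector [s, x, y, z]) \<in> sing_R \<longleftrightarrow>
      u \<noteq> 0 \<and> x = u^2 \<and> y = 1 \<and> z = 1 \<and> s = u + inverse u" for u s x y z
  proof (cases "u = 0")
    case False
    let ?p = "(u, vector [s, x, y, z] :: complex^4)"
    have nth: "((\<lambda>p::complex \<times> (complex^4). snd p $ i) has_derivative (\<lambda>p. snd p $ i)) (at q)" for i q
      by (intro bounded_linear.has_derivative[OF bounded_linear_vec_nth] has_derivative_snd has_derivative_ident)
    have fst: "((\<lambda>p::complex \<times> (complex^4). fst p) has_derivative (\<lambda>p. fst p)) (at q)" for q
      by (intro has_derivative_fst has_derivative_ident)
    define D where "D v = (u ^ 3 - u * x) * snd v $ 1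
      + (3 * s * u ^ 2 + 2 * u - (2 * u + s) * x - 2 * u * y - 2 * u * z) * fst v
      + (y * z + 2 * x - (u ^ 2 + s * u)) * snd v $ 2
      + (x * z - u ^ 2) * snd v $ 3 + (x * y - u ^ 2) * snd v $ 4" for v :: "complex \<times> (complex^4)"
    have D: "(?F has_derivative D) (at ?p)"
      using has_derivative_cubic[OF nth[of 1] fst nth[of 2] nth[of 3] nth[of 4], of ?p]
      unfolding D_def[abs_def] fst_conv snd_conv vector_4 .
    then have "(?F has_derivative (\<lambda>_. 0)) (at ?p) \<longleftrightarrow> D = (\<lambda>_. 0)"
      using has_derivative_unique by blast
    then have iff: "?p \<in> sing_R \<longleftrightarrow> cubic s u x y z = 0 \<and> D = (\<lambda>_. 0)"
      using False by (simp add: sing)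
    show ?thesis
    proof
      assume "?p \<in> sing_R"
      then have "D = (\<lambda>_. 0)" by (simp add: iff)
      then have "D (0, vector [1, 0, 0, 0]) = 0" "D (0, vector [0, 1, 0, 0]) = 0"
        "D (0, vector [0, 0, 1, 0]) = 0" "D (0, vector [0, 0, 0, 1]) = 0" by auto
      then have 1: "u ^ 3 = u * x" and 2: "y * z + 2 * x = u ^ 2 + s * u" and 3: "x * z = u ^ 2"
        and 4: "x * y = u ^ 2"
        by (auto simp: D_def)
      \<comment> \<open>The derivative along s1, absent in a fibre, forces x1 = s2^2. Hence the
        singular points of fibres with s1 = 2, s2 \<noteq> 1 or s1 = -2, s2 \<noteq> -1 are smooth
        points of the total space.\<close>
      from 1 False have x: "x = u^2" by (simp add: power3_eq_cube power2_eq_square)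
      with 3 4 False have yz: "y = 1" "z = 1" by auto
      from 2 x yz have "s * u = u * u + 1" by (simp add: power2_eq_square)
      then have "s = u + inverse u" using False by (simp add: field_simps)
      then show "u \<noteq> 0 \<and> x = u^2 \<and> y = 1 \<and> z = 1 \<and> s = u + inverse u" using False x yz by simp
    next
      assume h: "u \<noteq> 0 \<and> x = u^2 \<and> y = 1 \<and> z = 1 \<and> s = u + inverse u"
      then have xyz: "x = u^2" "y = 1" "z = 1" by auto
      \<comment> \<open>The relation in polynomial form; s occurs below through
        \<open>s * u\<close>, so no inverse has to be handled.\<close>
      have s: "s * u = u^2 + 1"
        using h by (metis distrib_right left_inverse power2_eq_square)
      have "cubic s u x y z = u^4 - u^2 * (s * u) - u^4 + u^2 * (s * u)"
        unfolding xyz by (simp add: cubic_def algebra_simps power2_eq_square power3_eq_cube power4_eq_xxxx)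
      then have c: "cubic s u x y z = 0" by simp
      have "3 * s * u ^ 2 + 2 * u - (2 * u + s) * x - 2 * u * y - 2 * u * z
          = 2 * u * (s * u) - 2 * u * (u^2 + 1)"
        unfolding xyz by (simp add: algebra_simps power2_eq_square)
      then have 1: "3 * s * u ^ 2 + 2 * u - (2 * u + s) * x - 2 * u * y - 2 * u * z = 0"
        by (simp add: s)
      have 2: "u ^ 3 - u * x = 0" "x * z - u ^ 2 = 0" "x * y - u ^ 2 = 0"
        unfolding xyz by (simp_all add: power2_eq_square power3_eq_cube)
      have 3: "y * z + 2 * x - (u ^ 2 + s * u) = 0"
        unfolding s xyz by simp
      have "D v = 0" for v
        by (simp only: D_def 1 2 3 mult_zero_left add_0_left)
      then have "D = (\<lambda>_. 0)" by (rule ext)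
      then show "?p \<in> sing_R"
        using c iff by blast
    qed
  qed (simp add: sing)
  show ?thesis
  proof (intro set_eqI iffI)
    fix p :: "complex \<times> (complex^4)" assume p: "p \<in> sing_R"
    have "p = (fst p, vector [snd p $ 1, snd p $ 2, snd p $ 3, snd p $ 4])"
      by (simp add: prod_eq_iff vec_eq_iff forall_4)
    then show "p \<in> {(s2, vector [s1, s2^2, 1, 1]) | s1 s2. s2 \<noteq> 0 \<and> s1 = s2 + inverse s2}"
      using p iff[of "fst p"] by (metis (mono_tags, lifting) mem_Collect_eq)
  next
    fix p :: "complex \<times> (complex^4)"
    assume "p \<in> {(s2, vector [s1, s2^2, 1, 1]) | s1 s2. s2 \<noteq> 0 \<and> s1 = s2 + inverse s2}"
    then show "p \<in> sing_R" using iff by blast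
  qed
qed

subsection \<open>Reducible data\<close>

text \<open>A line stable under the exponential torus is a coordinate axis, and an axis is stable
  under the Stokes matrices exactly when both lower or both upper parameters vanish.\<close>

lemma reducible_data_eq:
  "reducible_data = {(\<alpha>, a) | \<alpha> a. \<alpha> \<noteq> 0 \<and> (a $ 1 = 0 \<and> a $ 3 = 0 \<or> a $ 2 = 0 \<and> a $ 4 = 0)}"
proof -
  have diag: "diag2 v w *v x = vector [v * x $ 1, w * x $ 2]"
    and lower: "lower2 c *v x = vector [x $ 1, c * x $ 1 + x $ 2]"
    and upper: "upper2 c *v x = vector [x $ 1 + c * x $ 2, x $ 2]" for v w c :: complex and x
    by (simp_all add: vec_eq_iff forall_2 matrix_vector_mult_def sum_2 diag2_def lower2_def upper2_def)
  have line: "vec.subspace {x::complex^2. x $ i = 0}" for i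
    by (simp add: vec.subspace_def)
  have nonzero: "(vector [1, 0] :: complex^2) \<noteq> 0" "(vector [0, 1] :: complex^2) \<noteq> 0"
    by (simp_all add: vec_eq_iff forall_2)
  show ?thesis
  proof (intro set_eqI iffI)
    fix p :: "complex \<times> (complex^4)" assume "p \<in> reducible_data"
    then obtain W :: "(complex^2) set" where p: "fst p \<noteq> 0" and W: "vec.subspace W" "W \<noteq> {0}" "W \<noteq> UNIV"
      and M: "\<forall>M \<in> {diag2 c (inverse c) | c. c \<noteq> 0} \<union>
        {lower2 (snd p $ 1), upper2 (snd p $ 2), lower2 (snd p $ 3), upper2 (snd p $ 4)}.
        \<forall>v\<in>W. M *v v \<in> W"
      unfolding reducible_data_def analytic_data_def mem_Collect_eq by (elim conjE exE)
    have inv: "\<And>c v. c \<noteq> 0 \<Longrightarrow> v \<in> W \<Longrightarrow> diag2 c (inverse c) *v v \<in> W"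
        "\<And>v. v \<in> W \<Longrightarrow> lower2 (snd p $ 1) *v v \<in> W" "\<And>v. v \<in> W \<Longrightarrow> upper2 (snd p $ 2) *v v \<in> W"
        "\<And>v. v \<in> W \<Longrightarrow> lower2 (snd p $ 3) *v v \<in> W" "\<And>v. v \<in> W \<Longrightarrow> upper2 (snd p $ 4) *v v \<in> W"
      by (rule M[rule_format]; blast)+
    have scale: "vector [c * v $ 1, c * v $ 2] \<in> W" if "v \<in> W" for c v
    proof -
      have "vector [c * v $ 1, c * v $ 2] = c *s v" by (simp add: vec_eq_iff forall_2)
      then show ?thesis using vec.subspace_scale[OF W(1) that] by simp
    qed
    have sum: "vector [v $ 1 + w $ 1, v $ 2 + w $ 2] \<in> W" if "v \<in> W" "w \<in> W" for v w
    proof -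
      have "vector [v $ 1 + w $ 1, v $ 2 + w $ 2] = v + w" by (simp add: vec_eq_iff forall_2)
      then show ?thesis using vec.subspace_add[OF W(1) that] by simp
    qed
    have proj: "vector [v $ 1, 0] \<in> W" "vector [0, v $ 2] \<in> W" if "v \<in> W" for v
    proof -
      \<comment> \<open>The torus element with c = 2 has distinct eigenvalues 2 and 1/2; subtracting
        1/2 or 2 times v isolates one coordinate, up to the factor 3/2 or -3/2.\<close>
      have 2: "vector [2 * v $ 1, inverse 2 * v $ 2] \<in> W"
        using inv(1)[of 2 v] that by (simp add: diag)
      show "vector [v $ 1, 0] \<in> W"
        using scale[OF sum[OF 2 scale[OF that, of "- (1 / 2)"]], of "2 / 3"] by simp
      show "vector [0, v $ 2] \<in> W"
        using scale[OF sum[OF 2 scale[OF that, of "- 2"]], of "- (2 / 3)"] by simp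
    qed
    have e1: "vector [1, 0] \<in> W" if "v \<in> W" "v $ 1 \<noteq> 0" for v
      using scale[OF proj(1)[OF that(1)], of "inverse (v $ 1)"] that(2) by simp
    have e2: "vector [0, 1] \<in> W" if "v \<in> W" "v $ 2 \<noteq> 0" for v
      using scale[OF proj(2)[OF that(1)], of "inverse (v $ 2)"] that(2) by simp
    have not_both: "\<not> (vector [1, 0] \<in> W \<and> vector [0, 1] \<in> W)"
    proof
      assume h: "vector [1, 0] \<in> W \<and> vector [0, 1] \<in> W"
      have "v \<in> W" for v
      proof -
        have "vector [v $ 1, v $ 2] \<in> W"
          using sum[OF scale[of "vector [1, 0]" "v $ 1"] scale[of "vector [0, 1]" "v $ 2"]] h by simp
        moreover have "vector [v $ 1, v $ 2] = v" by (simp add: vec_eq_iff forall_2)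
        ultimately show ?thesis by simp
      qed
      then show False using W(3) by blast
    qed
    have "0 \<in> W" by (rule vec.subspace_0[OF W(1)])
    then obtain v where "v \<in> W" "v \<noteq> 0" using W(2) by blast
    then have "vector [1, 0] \<in> W \<or> vector [0, 1] \<in> W"
      using e1[of v] e2[of v] by (auto simp: vec_eq_iff forall_2)
    then have "snd p $ 1 = 0 \<and> snd p $ 3 = 0 \<or> snd p $ 2 = 0 \<and> snd p $ 4 = 0"
    proof
      assume h: "vector [1, 0] \<in> W"
      then have "vector [0, 1] \<notin> W" using not_both by blast
      then have "snd p $ 1 = 0" "snd p $ 3 = 0"
        using e2[OF inv(2)[OF h]] e2[OF inv(4)[OF h]] by (auto simp: lower)
      then show ?thesis by simp
    next
      assume h: "vector [0, 1] \<in> W"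
      then have "vector [1, 0] \<notin> W" using not_both by blast
      then have "snd p $ 2 = 0" "snd p $ 4 = 0"
        using e1[OF inv(3)[OF h]] e1[OF inv(5)[OF h]] by (auto simp: upper)
      then show ?thesis by simp
    qed
    then show "p \<in> {(\<alpha>, a) | \<alpha> a. \<alpha> \<noteq> 0 \<and> (a $ 1 = 0 \<and> a $ 3 = 0 \<or> a $ 2 = 0 \<and> a $ 4 = 0)}"
      using p by (cases p) auto
  next
    fix p :: "complex \<times> (complex^4)"
    assume "p \<in> {(\<alpha>, a) | \<alpha> a. \<alpha> \<noteq> 0 \<and> (a $ 1 = 0 \<and> a $ 3 = 0 \<or> a $ 2 = 0 \<and> a $ 4 = 0)}"
    then have p: "fst p \<noteq> 0" "snd p $ 1 = 0 \<and> snd p $ 3 = 0 \<or> snd p $ 2 = 0 \<and> snd p $ 4 = 0" by auto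
    \<comment> \<open>The vector v shows that the axis is not zero, and w that it is not the whole
      plane.\<close>
    have red: "p \<in> reducible_data"
      if M: "\<forall>M \<in> {diag2 c (inverse c) | c. c \<noteq> 0} \<union>
          {lower2 (snd p $ 1), upper2 (snd p $ 2), lower2 (snd p $ 3), upper2 (snd p $ 4)}.
          \<forall>v\<in>{x::complex^2. x $ i = 0}. M *v v \<in> {x. x $ i = 0}"
        and v: "v $ i = 0" "v \<noteq> 0" "w $ i \<noteq> 0" for i and v w :: "complex^2"
    proof -
      have "{x::complex^2. x $ i = 0} \<noteq> {0}" "{x::complex^2. x $ i = 0} \<noteq> UNIV"
        using v by blast+
      then show ?thesis
        unfolding reducible_data_def analytic_data_def
        by (intro CollectI conjI exI[of _ "{x. x $ i = 0}"] p(1) line M)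
    qed
    from p(2) show "p \<in> reducible_data"
    proof
      assume a: "snd p $ 1 = 0 \<and> snd p $ 3 = 0"
      show ?thesis
        by (rule red[of 2 "vector [1, 0]" "vector [0, 1]"])
           (use a in \<open>auto simp: nonzero diag lower upper\<close>)
    next
      assume a: "snd p $ 2 = 0 \<and> snd p $ 4 = 0"
      show ?thesis
        by (rule red[of 1 "vector [0, 1]" "vector [1, 0]"])
           (use a in \<open>auto simp: nonzero diag lower upper\<close>)
    qed
  qed
qed

lemma leval_generators:
  assumes "fst p \<noteq> 0"
  shows "leval tr_top p = fst p * (1 + snd p $ 2 * snd p $ 3) + inverse (fst p)
      * (snd p $ 1 * snd p $ 4 + (snd p $ 1 * snd p $ 2 + 1) * (snd p $ 3 * snd p $ 4 + 1))"
    and "leval x1 p = snd p $ 1 * snd p $ 4 + fst p ^ 2"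
    and "leval x2 p = snd p $ 1 * snd p $ 2 + 1" and "leval x3 p = snd p $ 3 * snd p $ 4 + 1"
proof -
  interpret ring_hom_fun "\<lambda>f. leval f p" by (rule ring_hom_leval[OF assms])
  show "leval tr_top p = fst p * (1 + snd p $ 2 * snd p $ 3) + inverse (fst p)
      * (snd p $ 1 * snd p $ 4 + (snd p $ 1 * snd p $ 2 + 1) * (snd p $ 3 * snd p $ 4 + 1))"
    by (simp add: tr_top_eq add mult one algebra_simps)
  show "leval x1 p = snd p $ 1 * snd p $ 4 + fst p ^ 2"
    and "leval x2 p = snd p $ 1 * snd p $ 2 + 1" and "leval x3 p = snd p $ 3 * snd p $ 4 + 1"
    by (simp_all add: x1_def x2_def x3_def add mult one power)
qed

text \<open>On reducible data all four products a_i a_j vanish, so the image depends on \<alpha>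
  alone, and zero Stokes parameters already reach every singular point.\<close>

lemma sing_R_image: "sing_R = gm_quotient_map ` reducible_data"
proof -
  have map: "gm_quotient_map p = (fst p, vector [fst p + inverse (fst p), fst p ^ 2, 1, 1])"
    if "p \<in> reducible_data" for p
  proof -
    have "fst p \<noteq> 0" "snd p $ 1 = 0 \<and> snd p $ 3 = 0 \<or> snd p $ 2 = 0 \<and> snd p $ 4 = 0"
      using that by (auto simp: reducible_data_eq)
    then show ?thesis
      by (auto simp: gm_quotient_map_def leval_generators)
  qed
  show ?thesis
  proof (intro set_eqI iffI)
    fix q assume "q \<in> sing_R"
    then obtain u where u: "u \<noteq> 0" "q = (u, vector [u + inverse u, u ^ 2, 1, 1])"
      by (auto simp: sing_R_eq)
    then have "(u, 0) \<in> reducible_data" by (simp add: reducible_data_eq)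
    then show "q \<in> gm_quotient_map ` reducible_data"
      using map u(2) by (metis fst_conv image_eqI)
  next
    fix q assume "q \<in> gm_quotient_map ` reducible_data"
    then obtain p where "p \<in> reducible_data" "q = gm_quotient_map p" by blast
    moreover from this have "fst p \<noteq> 0" by (auto simp: reducible_data_eq)
    ultimately show "q \<in> sing_R" by (auto simp: map sing_R_eq)
  qed
qed

subsection \<open>Singularity types\<close>

lemma holo_const: "holo S (\<lambda>_. c)"
  unfolding holo_def by (intro ballI exI[of _ "\<lambda>_. 0"]) simp

lemma holo_nth: "holo S (\<lambda>p. p $ i)"
  unfolding holo_def
  by (intro ballI exI[of _ "\<lambda>p. p $ i"])
     (simp add: bounded_linear.has_derivative[OF bounded_linear_vec_nth has_derivative_ident])

lemma holo_add:
  assumes "holo S f" "holo S g"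
  shows "holo S (\<lambda>p. f p + g p)"
  unfolding holo_def
proof
  fix p assume "p \<in> S"
  then obtain D E where "(f has_derivative D) (at p)" "\<forall>c v. D (c *s v) = c * D v"
    and "(g has_derivative E) (at p)" "\<forall>c v. E (c *s v) = c * E v"
    using assms unfolding holo_def by meson
  then show "\<exists>D. ((\<lambda>p. f p + g p) has_derivative D) (at p) \<and> (\<forall>c v. D (c *s v) = c * D v)"
    by (intro exI[of _ "\<lambda>v. D v + E v"]) (simp add: has_derivative_add distrib_left)
qed

lemma holo_mult:
  assumes "holo S f" "holo S g"
  shows "holo S (\<lambda>p. f p * g p)"
  unfolding holo_def
proof
  fix p assume "p \<in> S"
  then obtain D E where D: "(f has_derivative D) (at p)" "\<forall>c v. D (c *s v) = c * D v"
    and E: "(g has_derivative E) (at p)" "\<forall>c v. E (c *s v) = c * E v"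
    using assms unfolding holo_def by meson
  show "\<exists>D. ((\<lambda>p. f p * g p) has_derivative D) (at p) \<and> (\<forall>c v. D (c *s v) = c * D v)"
    by (intro exI conjI, rule has_derivative_mult[OF D(1) E(1)]) (simp add: D E algebra_simps)
qed

lemma holo_inverse:
  assumes "holo S f" "\<And>p. p \<in> S \<Longrightarrow> f p \<noteq> 0"
  shows "holo S (\<lambda>p. inverse (f p))"
  unfolding holo_def
proof
  fix p assume p: "p \<in> S"
  then obtain D where D: "(f has_derivative D) (at p)" "\<forall>c v. D (c *s v) = c * D v"
    using assms unfolding holo_def by meson
  show "\<exists>D. ((\<lambda>p. inverse (f p)) has_derivative D) (at p) \<and> (\<forall>c v. D (c *s v) = c * D v)"
    by (intro exI conjI, rule Deriv.has_derivative_inverse[OF assms(2)[OF p] D(1)]) (simp add: D algebra_simps)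
qed

lemma holo_diff: "holo S f \<Longrightarrow> holo S g \<Longrightarrow> holo S (\<lambda>p. f p - g p)"
  using holo_add[OF _ holo_mult[OF holo_const[of S "-1"]]] by fastforce

lemma holo_divide:
  "holo S f \<Longrightarrow> holo S g \<Longrightarrow> (\<And>p. p \<in> S \<Longrightarrow> g p \<noteq> 0) \<Longrightarrow> holo S (\<lambda>p. f p / g p)"
  unfolding divide_inverse by (intro holo_mult holo_inverse)

lemma holo_peval: "holo S (peval g)"
proof (induction g rule: poly3_induct)
  case (scalar c)
  show ?case using holo_const[of S c] by (simp add: fun_eq_iff cong: arg_cong2[of _ _ _ _ holo])
next
  case (Z i)
  show ?case using holo_nth[of S i] by simp
next
  case (add f g)
  then show ?case using holo_add[OF add] by (simp add: peval.add)
next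
  case (mult f g)
  then show ?case using holo_mult[OF mult] by (simp add: peval.mult)
qed

lemma holo_continuous_on: "holo S f \<Longrightarrow> continuous_on S f"
  by (meson continuous_at_imp_continuous_on has_derivative_continuous holo_def)

lemma holo_components_continuous_on:
  fixes f :: "complex^'n::finite \<Rightarrow> complex^'m::finite"
  assumes "\<And>i. holo S (\<lambda>p. f p $ i)"
  shows "continuous_on S f"
  using continuous_on_vec_lambda[of S "\<lambda>i p. f p $ i"] holo_continuous_on[OF assms] by simp

lemma x1_mult_cubic:
  fixes x y z :: complex
  shows "x * cubic s1 s2 x y z
    = (x * y - s2^2) * (x * z - s2^2) + (x - s2^2) * (x^2 - s1 * s2 * x + s2^2)"
  by (simp add: cubic_def algebra_simps power2_eq_square power3_eq_cube)

text \<open>Near a point with \<open>x \<noteq> 0\<close> the cubic surface is \<open>A B + P(x) = 0\<close> with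
  \<open>A = x y - s2\<^sup>2\<close>, \<open>B = x z - s2\<^sup>2\<close>. If \<open>P = q (x - r)^(n + 1)\<close> with \<open>q r \<noteq> 0\<close>, then dividing
  \<open>A\<close> by \<open>q\<close> gives coordinates in which the equation is \<open>A B + (x - r)^(n + 1) = 0\<close>. No root
  of \<open>q\<close> has to be extracted.\<close>

lemma fibre_type_A_of_root:
  fixes r m b s1 s2 :: complex
  defines "q \<equiv> \<lambda>x. m * x + b"
  assumes s2: "s2 \<noteq> 0" and r: "r \<noteq> 0" "q r \<noteq> 0"
    and P: "\<And>x. (x - s2^2) * (x^2 - s1 * s2 * x + s2^2) = q x * (x - r) ^ (n + 1)"
  shows "fibre_type_A n s1 s2 (vector [r, s2^2 / r, s2^2 / r])"
proof -
  \<comment> \<open>On S both x and q are units. T is the matching condition on the third new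
    coordinate x - r.\<close>
  define S where "S = {p::complex^3. p $ 1 \<noteq> 0 \<and> q (p $ 1) \<noteq> 0}"
  define T where "T = {w::complex^3. w $ 3 + r \<noteq> 0 \<and> q (w $ 3 + r) \<noteq> 0}"
  define A where "A p = (p $ 1 * p $ 2 - s2^2) / q (p $ 1)" for p :: "complex^3"
  define B where "B p = p $ 1 * p $ 3 - s2^2" for p :: "complex^3"
  \<comment> \<open>Chosen so that the squares of the first two coordinates add up to A B.\<close>
  define \<Phi> :: "complex^3 \<Rightarrow> complex^3"
    where "\<Phi> p = vector [(A p + B p) / 2, \<i> * (A p - B p) / 2, p $ 1 - r]" for p
  \<comment> \<open>Explicit inverse: A = w_1 - i w_2 and B = w_1 + i w_2 are linear in y and z
    respectively, with coefficients that are units on S. No inverse function theorem is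
    involved.\<close>
  define \<Psi> :: "complex^3 \<Rightarrow> complex^3"
    where "\<Psi> w = vector [w $ 3 + r, (q (w $ 3 + r) * (w $ 1 - \<i> * w $ 2) + s2^2) / (w $ 3 + r),
      (w $ 1 + \<i> * w $ 2 + s2^2) / (w $ 3 + r)]" for w
  define g where "g p = (\<Phi> p $ 1)^2 + (\<Phi> p $ 2)^2 + (\<Phi> p $ 3)^(n+1)" for p
  note holo_intros = holo_const holo_nth holo_add holo_diff holo_mult holo_divide
  have holo_q: "holo X (\<lambda>p. q (f p))" if "holo X f" for X and f :: "complex^3 \<Rightarrow> complex"
    unfolding q_def using that by (intro holo_intros)
  have holo_A: "holo S A" and holo_B: "holo S B"
    unfolding A_def[abs_def] B_def[abs_def]
    by (intro holo_intros holo_q; simp add: S_def)+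
  have \<Phi>: "holo S (\<lambda>p. \<Phi> p $ i)" for i
  proof -
    have "\<forall>i. holo S (\<lambda>p. \<Phi> p $ i)"
      unfolding forall_3 \<Phi>_def vector_3
      by (intro conjI holo_intros holo_A holo_B) simp_all
    then show ?thesis ..
  qed
  have \<Psi>: "holo T (\<lambda>w. \<Psi> w $ i)" for i
  proof -
    have "\<forall>i. holo T (\<lambda>w. \<Psi> w $ i)"
      unfolding forall_3 \<Psi>_def vector_3
      by (intro conjI holo_intros holo_q) (simp_all add: T_def)
    then show ?thesis ..
  qed
  have \<Phi>3: "\<Phi> p $ 3 = p $ 1 - r" for p
    by (simp add: \<Phi>_def)
  have AB\<Phi>: "\<Phi> p $ 1 - \<i> * \<Phi> p $ 2 = A p" "\<Phi> p $ 1 + \<i> * \<Phi> p $ 2 = B p" for p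
    by (simp_all add: \<Phi>_def field_simps)
  have hom: "homeomorphism S T \<Phi> \<Psi>"
  proof (rule homeomorphismI)
    show "continuous_on S \<Phi>" "continuous_on T \<Psi>"
      by (rule holo_components_continuous_on, rule \<Phi> \<Psi>)+
    show "\<Phi> ` S \<subseteq> T" "\<Psi> ` T \<subseteq> S"
      by (auto simp: S_def T_def \<Phi>_def \<Psi>_def)
    show "\<Psi> (\<Phi> p) = p" if "p \<in> S" for p
    proof -
      have x: "\<Phi> p $ 3 + r = p $ 1" by (simp add: \<Phi>_def)
      have "p $ 1 \<noteq> 0" "q (p $ 1) \<noteq> 0" using that by (auto simp: S_def)
      then show ?thesis
        unfolding vec_eq_iff forall_3 \<Psi>_def vector_3 x AB\<Phi> by (simp add: A_def B_def)
    qed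
    show "\<Phi> (\<Psi> w) = w" if "w \<in> T" for w
    proof -
      have "w $ 3 + r \<noteq> 0" "q (w $ 3 + r) \<noteq> 0" using that by (auto simp: T_def)
      then have A: "A (\<Psi> w) = w $ 1 - \<i> * w $ 2" and B: "B (\<Psi> w) = w $ 1 + \<i> * w $ 2"
        by (simp_all add: A_def B_def \<Psi>_def)
      have "\<Psi> w $ 1 - r = w $ 3" by (simp add: \<Psi>_def)
      then show ?thesis
        unfolding vec_eq_iff forall_3 \<Phi>_def vector_3 A B by (simp add: field_simps)
    qed
  qed
  \<comment> \<open>The cubic and the normal form differ by the unit q / x on S, so each generates
    the ideal of the other.\<close>
  have g: "p $ 1 * peval (cubic_fibre s1 s2) p = q (p $ 1) * g p" if "p \<in> S" for p
  proof -
    have "g p = A p * B p + (p $ 1 - r) ^ (n + 1)"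
      unfolding g_def AB\<Phi>[symmetric] \<Phi>3 by (simp add: algebra_simps power2_eq_square)
    moreover have "q (p $ 1) * A p = p $ 1 * p $ 2 - s2^2"
      using that by (simp add: A_def S_def)
    ultimately have "q (p $ 1) * g p = (p $ 1 * p $ 2 - s2^2) * B p + q (p $ 1) * (p $ 1 - r) ^ (n + 1)"
      by (simp only: distrib_left mult.assoc[symmetric])
    then show ?thesis
      unfolding peval_cubic_fibre x1_mult_cubic P B_def by simp
  qed
  have holo_units: "holo S (\<lambda>p. q (p $ 1) / p $ 1)" "holo S (\<lambda>p. p $ 1 / q (p $ 1))"
    by (intro holo_intros holo_q; simp add: S_def)+
  show ?thesis
    unfolding fibre_type_A_def singularity_type_A_def Let_def
  proof (intro exI conjI allI)
    show "open S"
      unfolding S_def q_def by (intro open_Collect_conj open_Collect_neq continuous_intros)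
    show "open T"
      unfolding T_def q_def by (intro open_Collect_conj open_Collect_neq continuous_intros)
    show "vector [r, s2^2 / r, s2^2 / r] \<in> S" using r by (simp add: S_def)
    show "\<Phi> (vector [r, s2^2 / r, s2^2 / r]) = 0"
      using r by (simp add: \<Phi>_def A_def B_def vec_eq_iff forall_3)
    show "homeomorphism S T \<Phi> \<Psi>" by (rule hom)
    show "holo S (\<lambda>q. \<Phi> q $ i)" "holo T (\<lambda>r. \<Psi> r $ i)" for i by (rule \<Phi> \<Psi>)+
    let ?g = "\<lambda>p. (\<Phi> p $ 1)^2 + (\<Phi> p $ 2)^2 + (\<Phi> p $ 3)^(n+1)"
    show "\<forall>f\<in>peval ` ideal_fibre s1 s2. \<exists>h. holo S h \<and> (\<forall>p\<in>S. f p = h p * ?g p)"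
      unfolding g_def[symmetric]
    proof
      fix f assume "f \<in> peval ` ideal_fibre s1 s2"
      then obtain k where f: "f = peval (cubic_fibre s1 s2 * k)"
        by (auto simp: ideal_fibre_eq[OF s2] dvd_def)
      have "f p = q (p $ 1) / p $ 1 * peval k p * g p" if "p \<in> S" for p
        using g[OF that] that by (simp add: f peval.mult S_def field_simps)
      moreover have "holo S (\<lambda>p. q (p $ 1) / p $ 1 * peval k p)"
        by (intro holo_mult holo_units holo_peval)
      ultimately show "\<exists>h. holo S h \<and> (\<forall>p\<in>S. f p = h p * g p)" by blast
    qed
    let ?c = "peval (cubic_fibre s1 s2)"
    show "finite {?c}" by simp
    show "{?c} \<subseteq> peval ` ideal_fibre s1 s2" by (simp add: ideal_fibre_eq[OF s2])
    show "\<forall>f\<in>{?c}. holo S ((\<lambda>_ p. p $ 1 / q (p $ 1)) f)"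
      using holo_units by simp
    show "\<forall>p\<in>S. ?g p = (\<Sum>f\<in>{?c}. (\<lambda>_ p. p $ 1 / q (p $ 1)) f p * f p)"
      unfolding g_def[symmetric]
    proof
      fix p assume "p \<in> S"
      with g[OF this] show "g p = (\<Sum>f\<in>{?c}. (\<lambda>_ p. p $ 1 / q (p $ 1)) f p * f p)"
        by (simp add: S_def field_simps)
    qed
  qed
qed

section \<open>The singular fibres case by case\<close>

lemma sing_fibre_nonempty_iff:
  assumes "s2 \<noteq> 0"
  shows "sing_fibre s1 s2 \<noteq> {} \<longleftrightarrow> (s1 - 2) * (s1 + 2) * (s2^2 - s1 * s2 + 1) = 0"
proof -
  have "sing_fibre s1 s2 \<noteq> {} \<longleftrightarrow> s2^2 - s1 * s2 + 1 = 0 \<or> s1 = 2 \<or> s1 = -2"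
    unfolding ex_in_conv[symmetric] sing_fibre_iff[OF assms] by blast
  then show ?thesis by (auto simp: eq_neg_iff_add_eq_0)
qed

text \<open>With s1 = 2 the reducible alternative requires (s2 - 1)^2 = 0, and at s2 = 1 it gives
  the same point; the A_2 fibre is therefore included.\<close>

lemma sing_fibre_s1_eq_2:
  assumes "s2 \<noteq> 0"
  shows "sing_fibre 2 s2 = {vector [s2, s2, s2]}"
proof -
  have "s2^2 - 2 * s2 + 1 = (s2 - 1)^2"
    by (simp add: power2_eq_square algebra_simps)
  then show ?thesis
    by (auto simp: sing_fibre_iff[OF assms])
qed

lemma sing_fibre_s1_eq_minus_2:
  assumes "s2 \<noteq> 0"
  shows "sing_fibre (-2) s2 = {vector [- s2, - s2, - s2]}"
proof -
  have "s2^2 + 2 * s2 + 1 = (s2 + 1)^2"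
    by (simp add: power2_eq_square algebra_simps)
  then show ?thesis
    by (auto simp: sing_fibre_iff[OF assms] add_eq_0_iff2)
qed

text \<open>The value s2 + 1/s2 equals 2 only at s2 = 1 and -2 only at s2 = -1, so one alternative
  remains.\<close>

lemma sing_fibre_reducible:
  assumes "s2 \<noteq> 0" "s2 \<noteq> 1" "s2 \<noteq> -1"
  shows "sing_fibre (s2 + inverse s2) s2 = {vector [s2^2, 1, 1]}"
proof -
  have s: "(s2 + inverse s2) * s2 = s2^2 + 1"
    using assms(1) by (simp add: distrib_right power2_eq_square)
  have "s2 + inverse s2 \<noteq> 2"
  proof
    assume "s2 + inverse s2 = 2"
    then have "(s2 - 1)^2 = 0" using s by (simp add: power2_eq_square algebra_simps)
    then show False using assms(2) by simp
  qed
  moreover have "s2 + inverse s2 \<noteq> -2"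
  proof
    assume "s2 + inverse s2 = -2"
    then have "s2^2 + 1 = -2 * s2" using s by simp
    moreover have "(s2 + 1)^2 = s2^2 + 1 + 2 * s2" by (simp add: power2_eq_square algebra_simps)
    ultimately have "(s2 + 1)^2 = 0" by simp
    then show False using assms(3) by (simp add: add_eq_0_iff2)
  qed
  ultimately show ?thesis
    by (auto simp: sing_fibre_iff[OF assms(1)] s)
qed

lemma fibre_type_A_s1_eq_2:
  assumes "s2 \<noteq> 0" "s2 \<noteq> 1"
  shows "fibre_type_A 1 2 s2 (vector [s2, s2, s2])"
proof -
  have "fibre_type_A 1 2 s2 (vector [s2, s2^2 / s2, s2^2 / s2])"
    \<comment> \<open>The quadratic factor is (x - s2)^2, so the cofactor is q = x - s2^2, with
      q(s2) = s2 (1 - s2).\<close>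
    by (rule fibre_type_A_of_root[where m = 1 and b = "- (s2^2)"])
       (use assms in \<open>simp_all add: power2_eq_square algebra_simps\<close>)
  then show ?thesis using assms(1) by (simp add: power2_eq_square)
qed

lemma fibre_type_A_s1_eq_minus_2:
  assumes "s2 \<noteq> 0" "s2 \<noteq> -1"
  shows "fibre_type_A 1 (-2) s2 (vector [- s2, - s2, - s2])"
proof -
  have "- s2 - s2^2 = - s2 * (s2 + 1)" by (simp add: power2_eq_square algebra_simps)
  then have "- s2 - s2^2 \<noteq> 0" using assms by (simp add: add_eq_0_iff2)
  then have "fibre_type_A 1 (-2) s2 (vector [- s2, s2^2 / - s2, s2^2 / - s2])"
    by (intro fibre_type_A_of_root[where m = 1 and b = "- (s2^2)"])
       (use assms in \<open>simp_all add: power2_eq_square algebra_simps\<close>)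
  then show ?thesis using assms(1) by (simp add: power2_eq_square)
qed

lemma fibre_type_A_reducible:
  assumes "s2 \<noteq> 0" "s2 \<noteq> 1" "s2 \<noteq> -1"
  shows "fibre_type_A 1 (s2 + inverse s2) s2 (vector [s2^2, 1, 1])"
proof -
  have s: "(s2 + inverse s2) * s2 = s2^2 + 1"
    using assms(1) by (simp add: distrib_right power2_eq_square)
  have "fibre_type_A 1 (s2 + inverse s2) s2 (vector [s2^2, s2^2 / s2^2, s2^2 / s2^2])"
  \<comment> \<open>The quadratic factor is (x - 1)(x - s2^2): the double root is s2^2 and the
    cofactor is x - 1.\<close>
  proof (rule fibre_type_A_of_root[where m = 1 and b = "-1"])
    show "(x - s2^2) * (x^2 - (s2 + inverse s2) * s2 * x + s2^2)
        = (1 * x + - 1) * (x - s2^2) ^ (1 + 1)" for x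
      unfolding s by (simp add: power2_eq_square algebra_simps)
  qed (use assms in \<open>simp_all add: power2_eq_1_iff\<close>)
  then show ?thesis using assms(1) by simp
qed

lemma fibre_type_A2:
  assumes "(s1, s2) \<in> {(2, 1), (-2, -1)}"
  shows "fibre_type_A 2 s1 s2 (vector [1, 1, 1])"
proof -
  have s: "s2 \<noteq> 0" "s2^2 = 1" "s1 * s2 = 2" using assms by auto
  have "fibre_type_A 2 s1 s2 (vector [1, s2^2 / 1, s2^2 / 1])"
  \<comment> \<open>Here s2^2 = 1 and s1 s2 = 2, so all three roots are 1 and the cofactor is the
    constant 1.\<close>
  proof (rule fibre_type_A_of_root[where m = 0 and b = 1])
    show "(x - s2^2) * (x^2 - s1 * s2 * x + s2^2) = (0 * x + 1) * (x - 1) ^ (2 + 1)" for x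
      unfolding s by (simp add: power2_eq_square power3_eq_cube algebra_simps)
  qed (use s(1) in simp_all)
  then show ?thesis by (simp add: s)
qed

theorem mainTheorem8:
  shows
    "range pres = O_R \<and>
     (\<forall>f. pres f = 0 \<longleftrightarrow> cubic_total dvd f) \<and>
     (\<forall>s1 s2. s2 \<noteq> 0 \<longrightarrow>
        (\<forall>f\<in>O_R. \<exists>g. f - psubst (vector [x1, x2, x3]) g \<in> fibre_ideal s1 s2) \<and>
        ideal_fibre s1 s2 = {g. cubic_fibre s1 s2 dvd g} \<and>
        total_degree (cubic_fibre s1 s2) = 3) \<and>
     sing_R = {(s2, vector [s1, s2^2, 1, 1]) | s1 s2. s2 \<noteq> 0 \<and> s1 = s2 + inverse s2} \<and>
     reducible_data = {(\<alpha>, a) | \<alpha> a. \<alpha> \<noteq> 0 \<and> (a $ 1 = 0 \<and> a $ 3 = 0 \<or> a $ 2 = 0 \<and> a $ 4 = 0)} \<and>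
     sing_R = gm_quotient_map ` reducible_data \<and>
     (\<forall>s1 s2. s2 \<noteq> 0 \<longrightarrow>
        (sing_fibre s1 s2 \<noteq> {} \<longleftrightarrow> (s1 - 2) * (s1 + 2) * (s2^2 - s1 * s2 + 1) = 0)) \<and>
     (\<forall>s2. s2 \<noteq> 0 \<and> s2 \<noteq> 1 \<longrightarrow>
        sing_fibre 2 s2 = {vector [s2, s2, s2]} \<and>
        fibre_type_A 1 2 s2 (vector [s2, s2, s2])) \<and>
     (\<forall>s2. s2 \<noteq> 0 \<and> s2 \<noteq> -1 \<longrightarrow>
        sing_fibre (-2) s2 = {vector [- s2, - s2, - s2]} \<and>
        fibre_type_A 1 (-2) s2 (vector [- s2, - s2, - s2])) \<and>
     (\<forall>s2. s2 \<noteq> 0 \<and> s2 \<noteq> 1 \<and> s2 \<noteq> -1 \<longrightarrow>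
        sing_fibre (s2 + inverse s2) s2 = {vector [s2^2, 1, 1]} \<and>
        fibre_type_A 1 (s2 + inverse s2) s2 (vector [s2^2, 1, 1])) \<and>
     (\<forall>(s1, s2) \<in> {(2, 1), (-2, -1)}.
        sing_fibre s1 s2 = {vector [1, 1, 1]} \<and>
        fibre_type_A 2 s1 s2 (vector [1, 1, 1]))"
proof (intro conjI allI impI)
  show "range pres = O_R" by (rule range_pres)
  show "pres f = 0 \<longleftrightarrow> cubic_total dvd f" for f by (rule pres_eq_0_iff)
  show "sing_R = {(s2, vector [s1, s2^2, 1, 1]) | s1 s2. s2 \<noteq> 0 \<and> s1 = s2 + inverse s2}"
    by (rule sing_R_eq)
  show "reducible_data
      = {(\<alpha>, a) | \<alpha> a. \<alpha> \<noteq> 0 \<and> (a $ 1 = 0 \<and> a $ 3 = 0 \<or> a $ 2 = 0 \<and> a $ 4 = 0)}"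
    by (rule reducible_data_eq)
  show "sing_R = gm_quotient_map ` reducible_data" by (rule sing_R_image)
next
  fix s1 s2 :: complex assume s2: "s2 \<noteq> 0"
  show "\<forall>f\<in>O_R. \<exists>g. f - psubst (vector [x1, x2, x3]) g \<in> fibre_ideal s1 s2"
    using fibre_coordinates[OF s2] by blast
  show "ideal_fibre s1 s2 = {g. cubic_fibre s1 s2 dvd g}" by (rule ideal_fibre_eq[OF s2])
  show "total_degree (cubic_fibre s1 s2) = 3" by (rule total_degree_cubic_fibre)
  show "sing_fibre s1 s2 \<noteq> {} \<longleftrightarrow> (s1 - 2) * (s1 + 2) * (s2^2 - s1 * s2 + 1) = 0"
    by (rule sing_fibre_nonempty_iff[OF s2])
next
  fix s2 :: complex assume "s2 \<noteq> 0 \<and> s2 \<noteq> 1"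
  then show "sing_fibre 2 s2 = {vector [s2, s2, s2]}" "fibre_type_A 1 2 s2 (vector [s2, s2, s2])"
    using sing_fibre_s1_eq_2 fibre_type_A_s1_eq_2 by blast+
next
  fix s2 :: complex assume "s2 \<noteq> 0 \<and> s2 \<noteq> -1"
  then show "sing_fibre (-2) s2 = {vector [- s2, - s2, - s2]}"
    "fibre_type_A 1 (-2) s2 (vector [- s2, - s2, - s2])"
    using sing_fibre_s1_eq_minus_2 fibre_type_A_s1_eq_minus_2 by blast+
next
  fix s2 :: complex assume "s2 \<noteq> 0 \<and> s2 \<noteq> 1 \<and> s2 \<noteq> -1"
  then show "sing_fibre (s2 + inverse s2) s2 = {vector [s2^2, 1, 1]}"
    "fibre_type_A 1 (s2 + inverse s2) s2 (vector [s2^2, 1, 1])"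
    using sing_fibre_reducible fibre_type_A_reducible by blast+
next
  have "sing_fibre s1 s2 = {vector [1, 1, 1]} \<and> fibre_type_A 2 s1 s2 (vector [1, 1, 1])"
    if "(s1, s2) \<in> {(2, 1), (-2, -1)}" for s1 s2
    using that fibre_type_A2[OF that] sing_fibre_s1_eq_2[of 1] sing_fibre_s1_eq_minus_2[of "-1"]
    by auto
  then show "\<forall>(s1, s2) \<in> {(2, 1), (-2, -1)}.
      sing_fibre s1 s2 = {vector [1, 1, 1]} \<and> fibre_type_A 2 s1 s2 (vector [1, 1, 1])"
    by blast
qed

end
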